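(* There exist absolute constants $c>0$ and $C>0$ such that the following holds. Let $n\ge2$ be an integer and $L,\mu,\Delta,\varepsilon>0$ satisfy $\kappa:=L/\mu\ge\sqrt{3/n}\,(n/2+1)$ and $\varepsilon/\Delta\le0.00327$. Then for every PIFO algorithm $\mathcal{A}$ there exist a dimension $d\le C\,n^{-1/4}\sqrt{\kappa}\log(\Delta/\varepsilon)$ and functions $f_1,\dots,f_n:\mathbb{R}^d\to\mathbb{R}$ such that $\{f_i\}_{i=1}^n$ is $L$-average smooth, $f=\frac1n\sum_i f_i$ is $\mu$-strongly convex, $f(x_0)-f(x^* )=\Delta$ (with $x^*$ the minimizer of $f$ and $x_0$ the initial point of $\mathcal{A}$), and the iterates of $\mathcal{A}$ satisfy $\mathbb{E} f(x_t)-f(x^* )\ge\varepsilon$ for all integers $0\le t\le c\,(n+n^{3/4}\sqrt{\kappa})\log(\Delta/\varepsilon)$. That is, $\mathcal{A}$ needs $\Omega\big((n+n^{3/4}\sqrt\kappa)\log(\Delta/\varepsilon)\big)$ oracle queries.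
   Context: Differentiable $f_1,\dots,f_n:\mathbb{R}^d\to\mathbb{R}$ are $L$-average smooth if $\frac1n\sum_{i=1}^n\|\nabla f_i(x)-\nabla f_i(y)\|_2^2\le L^2\|x-y\|_2^2$ for all $x,y$. A differentiable $g$ is $\mu$-strongly convex if $g(y)\ge g(x)+\langle\nabla g(x),y-x\rangle+\frac{\mu}{2}\|y-x\|_2^2$ for all $x,y$. For $\gamma>0$, $\mathrm{prox}^{\gamma}_g(x)=\arg\min_u\{g(u)+\frac{1}{2\gamma}\|x-u\|_2^2\}$. PIFO algorithm: given $f_1,\dots,f_n:\mathbb{R}^d\to\mathbb{R}$ and $f=\frac1n\sum_i f_i$, a PIFO algorithm $\mathcal{A}$ is specified by a probability vector $(p_1,\dots,p_n)$ ($p_j\ge0$, $\sum_j p_j=1$), an initial point $x_0$ and parameters $\gamma_t>0$; it draws indices $i_1,i_2,\dots$ independently with $\mathbb{P}(i_t=j)=p_j$, at step $t\ge1$ queries the oracle $h_f(x_{t-1},i_t,\gamma_t)=[f_{i_t}(x_{t-1}),\nabla f_{i_t}(x_{t-1}),\mathrm{prox}^{\gamma_t}_{f_{i_t}}(x_{t-1})]$, and outputs an iterate $x_t\in\mathrm{span}\{x_0,\dots,x_{t-1},\nabla f_{i_1}(x_0),\dots,\nabla f_{i_t}(x_{t-1}),\mathrm{prox}^{\gamma_1}_{f_{i_1}}(x_0),\dots,\mathrm{prox}^{\gamma_t}_{f_{i_t}}(x_{t-1})\}$ (the choice within the span may depend on all previously observed information). Iterate $x_t$ uses $t$ oracle queries.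 *)

theory Defs
  imports "HOL-Analysis.Analysis" "HOL-Probability.Probability"
begin

text \<open>Vectors of R^d are represented as functions nat => real vanishing at all
  coordinates i >= d (coordinates 0..d-1).\<close>

type_synonym vec = "nat \<Rightarrow> real"

definition Rd :: "nat \<Rightarrow> vec set" where
  "Rd d = {x. \<forall>i\<ge>d. x i = 0}"

definition vinner :: "nat \<Rightarrow> vec \<Rightarrow> vec \<Rightarrow> real" where
  "vinner d x y = (\<Sum>i<d. x i * y i)"

definition vnorm :: "nat \<Rightarrow> vec \<Rightarrow> real" where
  "vnorm d x = sqrt (vinner d x x)"

definition vadd :: "vec \<Rightarrow> vec \<Rightarrow> vec" where
  "vadd x y = (\<lambda>i. x i + y i)"

definition vsub :: "vec \<Rightarrow> vec \<Rightarrow> vec" where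
  "vsub x y = (\<lambda>i. x i - y i)"

definition vspan :: "vec set \<Rightarrow> vec set" where
  "vspan S = {x. \<exists>F c. finite F \<and> F \<subseteq> S \<and> x = (\<lambda>i. \<Sum>v\<in>F. c v * v i)}"

definition has_grad :: "nat \<Rightarrow> (vec \<Rightarrow> real) \<Rightarrow> vec \<Rightarrow> vec \<Rightarrow> bool" where
  "has_grad d g x v \<longleftrightarrow> v \<in> Rd d \<and>
     (\<forall>e>0. \<exists>\<delta>>0. \<forall>h\<in>Rd d. vnorm d h < \<delta> \<longrightarrow>
        \<bar>g (vadd x h) - g x - vinner d v h\<bar> \<le> e * vnorm d h)"

definition differentiable_Rd :: "nat \<Rightarrow> (vec \<Rightarrow> real) \<Rightarrow> bool" where
  "differentiable_Rd d g \<longleftrightarrow> (\<forall>x\<in>Rd d. \<exists>v. has_grad d g x v)"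

definition grad :: "nat \<Rightarrow> (vec \<Rightarrow> real) \<Rightarrow> vec \<Rightarrow> vec" where
  "grad d g x = (SOME v. has_grad d g x v)"

definition prox :: "nat \<Rightarrow> real \<Rightarrow> (vec \<Rightarrow> real) \<Rightarrow> vec \<Rightarrow> vec" where
  "prox d \<gamma> g x = (SOME u. u \<in> Rd d \<and>
     (\<forall>w\<in>Rd d. g u + (vnorm d (vsub x u))\<^sup>2 / (2 * \<gamma>) \<le> g w + (vnorm d (vsub x w))\<^sup>2 / (2 * \<gamma>)))"

definition avg_smooth :: "nat \<Rightarrow> nat \<Rightarrow> real \<Rightarrow> (nat \<Rightarrow> vec \<Rightarrow> real) \<Rightarrow> bool" where
  "avg_smooth d n L f \<longleftrightarrow> (\<forall>i<n. differentiable_Rd d (f i)) \<and>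
     (\<forall>x\<in>Rd d. \<forall>y\<in>Rd d.
        (1 / real n) * (\<Sum>i<n. (vnorm d (vsub (grad d (f i) x) (grad d (f i) y)))\<^sup>2)
          \<le> L\<^sup>2 * (vnorm d (vsub x y))\<^sup>2)"

definition strongly_convex_Rd :: "nat \<Rightarrow> real \<Rightarrow> (vec \<Rightarrow> real) \<Rightarrow> bool" where
  "strongly_convex_Rd d \<mu> g \<longleftrightarrow> differentiable_Rd d g \<and>
     (\<forall>x\<in>Rd d. \<forall>y\<in>Rd d.
        g y \<ge> g x + vinner d (grad d g x) (vsub y x) + \<mu> / 2 * (vnorm d (vsub y x))\<^sup>2)"

definition favg :: "nat \<Rightarrow> (nat \<Rightarrow> vec \<Rightarrow> real) \<Rightarrow> vec \<Rightarrow> real" where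
  "favg n f x = (1 / real n) * (\<Sum>i<n. f i x)"

text \<open>One oracle observation: (index i_t, f_{i_t}(x_{t-1}), grad f_{i_t}(x_{t-1}), prox(x_{t-1})).\<close>
type_synonym obs = "nat \<times> real \<times> vec \<times> vec"

text \<open>Run of a PIFO algorithm in dimension d with step parameters gam, initial point x0 and
  update rule upd (x_t = upd t history_t for t >= 1), on index sequence om (i_t = om t, t >= 1).\<close>
fun pifo_hist :: "nat \<Rightarrow> (nat \<Rightarrow> vec \<Rightarrow> real) \<Rightarrow> (nat \<Rightarrow> real) \<Rightarrow> vec \<Rightarrow>
    (nat \<Rightarrow> obs list \<Rightarrow> vec) \<Rightarrow> (nat \<Rightarrow> nat) \<Rightarrow> nat \<Rightarrow> obs list" where
  "pifo_hist d f gam x0 upd om 0 = []"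
| "pifo_hist d f gam x0 upd om (Suc t) =
     (let h = pifo_hist d f gam x0 upd om t;
          x = (if t = 0 then x0 else upd t h);
          i = om (Suc t)
      in h @ [(i, f i x, grad d (f i) x, prox d (gam (Suc t)) (f i) x)])"

definition pifo_iter :: "nat \<Rightarrow> (nat \<Rightarrow> vec \<Rightarrow> real) \<Rightarrow> (nat \<Rightarrow> real) \<Rightarrow> vec \<Rightarrow>
    (nat \<Rightarrow> obs list \<Rightarrow> vec) \<Rightarrow> (nat \<Rightarrow> nat) \<Rightarrow> nat \<Rightarrow> vec" where
  "pifo_iter d f gam x0 upd om t =
     (if t = 0 then x0 else upd t (pifo_hist d f gam x0 upd om t))"

definition pifo_alg :: "nat \<Rightarrow> nat \<Rightarrow> nat pmf \<Rightarrow> (nat \<Rightarrow> real) \<Rightarrow> vec \<Rightarrow>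
    (nat \<Rightarrow> obs list \<Rightarrow> vec) \<Rightarrow> bool" where
  "pifo_alg n d P gam x0 upd \<longleftrightarrow>
     set_pmf P \<subseteq> {..<n} \<and> (\<forall>t. gam t > 0) \<and> x0 \<in> Rd d \<and>
     (\<forall>f om t. (\<forall>s. om s < n) \<longrightarrow> t \<ge> 1 \<longrightarrow>
        pifo_iter d f gam x0 upd om t \<in>
          vspan ({pifo_iter d f gam x0 upd om s | s. s < t}
                 \<union> {fst (snd (snd ob)) | ob. ob \<in> set (pifo_hist d f gam x0 upd om t)}
                 \<union> {snd (snd (snd ob)) | ob. ob \<in> set (pifo_hist d f gam x0 upd om t)}))"

definition pifo_expect :: "nat \<Rightarrow> (nat \<Rightarrow> vec \<Rightarrow> real) \<Rightarrow> nat pmf \<Rightarrow> (nat \<Rightarrow> real) \<Rightarrow> vec \<Rightarrow>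
    (nat \<Rightarrow> obs list \<Rightarrow> vec) \<Rightarrow> (vec \<Rightarrow> real) \<Rightarrow> nat \<Rightarrow> real" where
  "pifo_expect d f P gam x0 upd F t =
     measure_pmf.expectation (Pi_pmf {1..t} 0 (\<lambda>_. P))
       (\<lambda>om. F (pifo_iter d f gam x0 upd om t))"

end

theory Submission
  imports Defs
begin

text \<open>
  The averaged function is, in suitable orthonormal coordinates centred at the initial point,
  \<open>\<mu>/2 |y - B e_0|^2 + c/2 \<Sum>_j (y_j - y_{j+1})^2\<close>. Its minimiser is the geometric sequence
  \<open>B (1 - q) q^j\<close> with \<open>c (1 - q)^2 = \<mu> q\<close>. As no edge anchors the first vertex, the initial
  gap exceeds the gap of a point supported on the first \<open>k\<close> coordinates only by a factor of
  order \<open>q^(-2k)\<close>, without any loss depending on the condition number.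

  The regulariser is shared by all summands, whereas the edges are given alternately to the two
  indices \<open>a\<close>, \<open>b\<close> the algorithm draws least often, so that \<open>p_a + p_b \<le> 3/n\<close>. Average
  smoothness only sees the mean square of the gradients and permits \<open>c\<close> of order
  \<open>L / sqrt n\<close>. The edges inside one summand are disjoint, hence a gradient or a proximal step
  discovers at most one new coordinate, and none unless \<open>a\<close> or \<open>b\<close> is drawn. If \<open>N\<close> is the
  number of such draws, Jensen's inequality gives \<open>E q^(2N) \<ge> q^(6t/n)\<close>.

  The span of the iterates contains the initial point; the coordinates are rotated so that this
  point lies on the first axis, which costs one further coordinate.
\<close>

section \<open>Gradients, proximal points and isometries\<close>

lemma vnorm_sq: "(vnorm d x)\<^sup>2 = (\<Sum>j<d. (x j)\<^sup>2)"
  unfolding vnorm_def vinner_def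
  by (subst real_sqrt_pow2) (auto intro!: sum_nonneg simp: power2_eq_square)

lemma vnorm_nonneg: "vnorm d x \<ge> 0"
  unfolding vnorm_def vinner_def by (auto intro!: sum_nonneg)

lemma vnorm_scale: "vnorm d (\<lambda>i. s * x i) = \<bar>s\<bar> * vnorm d x"
proof (rule power2_eq_imp_eq)
  show "(vnorm d (\<lambda>i. s * x i))\<^sup>2 = (\<bar>s\<bar> * vnorm d x)\<^sup>2"
    by (simp add: vnorm_sq power_mult_distrib sum_distrib_left)
qed (simp_all add: vnorm_nonneg)

lemma Rd_eqI: "x \<in> Rd d \<Longrightarrow> y \<in> Rd d \<Longrightarrow> (\<And>j. j < d \<Longrightarrow> x j = y j) \<Longrightarrow> x = y"
  by (rule ext) (metis (mono_tags, lifting) Rd_def mem_Collect_eq not_less)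

lemma Rd_mono: "k \<le> k' \<Longrightarrow> Rd k \<subseteq> Rd k'"
  by (auto simp: Rd_def)

lemma vsub_Rd: "x \<in> Rd d \<Longrightarrow> y \<in> Rd d \<Longrightarrow> vsub x y \<in> Rd d"
  by (simp add: Rd_def vsub_def)

lemma vadd_Rd: "x \<in> Rd d \<Longrightarrow> y \<in> Rd d \<Longrightarrow> vadd x y \<in> Rd d"
  by (simp add: Rd_def vadd_def)

lemma vnorm_eq_0:
  assumes "x \<in> Rd d" "vnorm d x = 0"
  shows "x = (\<lambda>_. 0)"
proof (rule Rd_eqI[OF assms(1)])
  show "(\<lambda>_. 0) \<in> Rd d" by (simp add: Rd_def)
  have "(\<Sum>j<d. (x j)\<^sup>2) = 0" using assms(2) vnorm_sq[of d x] by simp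
  then show "x j = 0" if "j < d" for j
    using that by (subst (asm) sum_nonneg_eq_0_iff) auto
qed

text \<open>Both expansions are tested along a short multiple of the difference of the two
  candidates, where the linear terms lie further apart than the errors allow. This determines the
  choice made in \<open>grad\<close>.\<close>

lemma has_grad_unique:
  assumes v: "has_grad d g x v" and w: "has_grad d g x w"
  shows "v = w"
proof (rule ccontr)
  assume ne: "v \<noteq> w"
  define u where "u = vsub v w"
  have Rv: "v \<in> Rd d" and Rw: "w \<in> Rd d" using v w by (auto simp: has_grad_def)
  have uR: "u \<in> Rd d" using Rv Rw by (simp add: u_def vsub_Rd)
  have "u \<noteq> (\<lambda>_. 0)" using ne by (auto simp: u_def vsub_def fun_eq_iff)
  then have up: "vnorm d u > 0"
    using vnorm_eq_0[OF uR] vnorm_nonneg[of d u] by fastforce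
  define e where "e = vnorm d u / 4"
  have e: "e > 0" using up by (simp add: e_def)
  obtain d1 where d1: "d1 > 0" "\<And>h. h \<in> Rd d \<Longrightarrow> vnorm d h < d1 \<Longrightarrow>
      \<bar>g (vadd x h) - g x - vinner d v h\<bar> \<le> e * vnorm d h"
    using v e unfolding has_grad_def by blast
  obtain d2 where d2: "d2 > 0" "\<And>h. h \<in> Rd d \<Longrightarrow> vnorm d h < d2 \<Longrightarrow>
      \<bar>g (vadd x h) - g x - vinner d w h\<bar> \<le> e * vnorm d h"
    using w e unfolding has_grad_def by blast
  define s where "s = min d1 d2 / (2 * vnorm d u)"
  have s: "s > 0" using up d1 d2 by (simp add: s_def)
  define h where "h = (\<lambda>i. s * u i)"
  have hR: "h \<in> Rd d" using uR by (simp add: h_def Rd_def)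
  have hn: "vnorm d h = s * vnorm d u" using s by (simp add: h_def vnorm_scale)
  have hs: "s * vnorm d u = min d1 d2 / 2" using up by (simp add: s_def)
  have lt: "vnorm d h < d1" "vnorm d h < d2" using d1(1) d2(1) hn hs by linarith+
  have "vinner d v h - vinner d w h = s * vinner d u u"
    by (simp add: vinner_def h_def u_def vsub_def sum_distrib_left sum_subtractf[symmetric] algebra_simps)
  also have "vinner d u u = (vnorm d u)\<^sup>2"
    unfolding vnorm_sq by (simp add: vinner_def power2_eq_square)
  finally have "s * (vnorm d u)\<^sup>2 \<le> 2 * (e * vnorm d h)"
    using d1(2)[OF hR lt(1)] d2(2)[OF hR lt(2)] by linarith
  also have "\<dots> = s * (vnorm d u)\<^sup>2 / 2" by (simp add: hn e_def power2_eq_square)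
  finally show False using s up by simp
qed

lemma grad_eqI: "has_grad d g x v \<Longrightarrow> grad d g x = v"
  unfolding grad_def by (rule some_equality) (auto intro: has_grad_unique)

lemma has_grad_quadraticI:
  assumes "v \<in> Rd d"
    and "\<And>h. h \<in> Rd d \<Longrightarrow> \<bar>g (vadd x h) - g x - vinner d v h\<bar> \<le> K * (vnorm d h)\<^sup>2"
  shows "has_grad d g x v"
  unfolding has_grad_def
proof (intro conjI allI impI)
  fix e :: real assume e: "e > 0"
  show "\<exists>\<delta>>0. \<forall>h\<in>Rd d. vnorm d h < \<delta> \<longrightarrow> \<bar>g (vadd x h) - g x - vinner d v h\<bar> \<le> e * vnorm d h"
  proof (intro exI[of _ "e / (\<bar>K\<bar> + 1)"] conjI ballI impI)
    show "0 < e / (\<bar>K\<bar> + 1)" using e by simp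
    fix h assume h: "h \<in> Rd d" "vnorm d h < e / (\<bar>K\<bar> + 1)"
    have "(\<bar>K\<bar> + 1) * vnorm d h \<le> e" using h(2) by (simp add: field_simps)
    moreover have "K * vnorm d h \<le> (\<bar>K\<bar> + 1) * vnorm d h"
      using vnorm_nonneg[of d h] by (intro mult_right_mono) auto
    ultimately have "K * vnorm d h * vnorm d h \<le> e * vnorm d h"
      using vnorm_nonneg[of d h] by (intro mult_right_mono) auto
    then show "\<bar>g (vadd x h) - g x - vinner d v h\<bar> \<le> e * vnorm d h"
      using assms(2)[OF h(1)] by (simp add: power2_eq_square mult.assoc)
  qed
qed (rule assms(1))

text \<open>The surplus \<open>(vnorm d (vsub w u))\<^sup>2 / (2 * \<gamma>)\<close> in the
  hypothesis forces every other minimiser to coincide with \<open>u\<close>, so the choice in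
  \<open>prox\<close> is determined.\<close>

lemma prox_eqI:
  assumes "u \<in> Rd d" and "\<gamma> > 0"
    and "\<And>w. w \<in> Rd d \<Longrightarrow> g w + (vnorm d (vsub x w))\<^sup>2 / (2 * \<gamma>)
      \<ge> g u + (vnorm d (vsub x u))\<^sup>2 / (2 * \<gamma>) + (vnorm d (vsub w u))\<^sup>2 / (2 * \<gamma>)"
  shows "prox d \<gamma> g x = u"
  unfolding prox_def
proof (rule some_equality)
  have nn: "(vnorm d (vsub w u))\<^sup>2 / (2 * \<gamma>) \<ge> 0" for w using assms(2) by simp
  show "u \<in> Rd d \<and> (\<forall>w\<in>Rd d. g u + (vnorm d (vsub x u))\<^sup>2 / (2 * \<gamma>)
      \<le> g w + (vnorm d (vsub x w))\<^sup>2 / (2 * \<gamma>))"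
    using assms(1,3) nn by (meson add_increasing2 order_trans order_refl)
  fix w assume w: "w \<in> Rd d \<and> (\<forall>z\<in>Rd d. g w + (vnorm d (vsub x w))\<^sup>2 / (2 * \<gamma>)
      \<le> g z + (vnorm d (vsub x z))\<^sup>2 / (2 * \<gamma>))"
  then have "(vnorm d (vsub w u))\<^sup>2 / (2 * \<gamma>) \<le> 0"
    using assms(1) assms(3)[of w] by fastforce
  then have "(vnorm d (vsub w u))\<^sup>2 / (2 * \<gamma>) = 0" using nn[of w] by linarith
  then have "vnorm d (vsub w u) = 0" using assms(2) by simp
  then have "vsub w u = (\<lambda>_. 0)" using w assms(1) by (intro vnorm_eq_0 vsub_Rd) auto
  then show "w = u" by (simp add: vsub_def fun_eq_iff)
qed

section \<open>Orthogonal changes of coordinates\<close>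

locale linear_isometry_Rd =
  fixes m :: nat and H :: "vec \<Rightarrow> vec"
  assumes H_Rd: "x \<in> Rd m \<Longrightarrow> H x \<in> Rd m"
    and H_lin: "H (\<lambda>i. a * x i + b * y i) = (\<lambda>i. a * H x i + b * H y i)"
    and H_inv: "x \<in> Rd m \<Longrightarrow> H (H x) = x"
    and H_inner: "x \<in> Rd m \<Longrightarrow> y \<in> Rd m \<Longrightarrow> vinner m (H x) (H y) = vinner m x y"
begin

lemma H_zero: "H (\<lambda>_. 0) = (\<lambda>_. 0)"
  using H_lin[of 0 "\<lambda>_. 0" 0 "\<lambda>_. 0"] by simp

lemma H_vadd: "H (vadd x y) = vadd (H x) (H y)"
  using H_lin[of 1 x 1 y] by (simp add: vadd_def)

lemma H_vsub: "H (vsub x y) = vsub (H x) (H y)"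
  using H_lin[of 1 x "-1" y] by (simp add: vsub_def)

text \<open>An isometry that is its own inverse is self-adjoint, so the same map changes variables
  and pulls gradients back.\<close>

lemma H_adjoint: "x \<in> Rd m \<Longrightarrow> y \<in> Rd m \<Longrightarrow> vinner m (H x) y = vinner m x (H y)"
  using H_inner[of x "H y"] H_inv[of y] H_Rd[of y] by simp

lemma H_norm: "x \<in> Rd m \<Longrightarrow> vnorm m (H x) = vnorm m x"
  by (simp add: vnorm_def H_inner)

lemma H_sum: "finite F \<Longrightarrow> H (\<lambda>i. \<Sum>v\<in>F. c v * v i) = (\<lambda>i. \<Sum>v\<in>F. c v * H v i)"
proof (induction F rule: finite_induct)
  case empty
  then show ?case by (simp add: H_zero)
next
  case (insert w F)
  have "H (\<lambda>i. \<Sum>v\<in>insert w F. c v * v i) = H (\<lambda>i. c w * w i + 1 * (\<Sum>v\<in>F. c v * v i))"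
    using insert by simp
  also have "\<dots> = (\<lambda>i. c w * H w i + 1 * H (\<lambda>i. \<Sum>v\<in>F. c v * v i) i)"
    by (rule H_lin)
  finally show ?case using insert by simp
qed

text \<open>Nested subspaces recording what an algorithm can have discovered: \<open>k\<close>
  coordinates of the rotated frame.\<close>

definition flag :: "nat \<Rightarrow> vec set" where
  "flag k = {x \<in> Rd m. H x \<in> Rd k}"

lemma flag_mono: "k \<le> k' \<Longrightarrow> flag k \<subseteq> flag k'"
  using Rd_mono[of k k'] by (auto simp: flag_def)

lemma vspan_flag: "S \<subseteq> flag k \<Longrightarrow> vspan S \<subseteq> flag k"
proof
  fix x assume S: "S \<subseteq> flag k" and "x \<in> vspan S"
  then obtain F c where F: "finite F" "F \<subseteq> S" and x: "x = (\<lambda>i. \<Sum>v\<in>F. c v * v i)"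
    unfolding vspan_def by auto
  have *: "v \<in> Rd m" "H v \<in> Rd k" if "v \<in> F" for v using that F S by (auto simp: flag_def)
  show "x \<in> flag k"
    using * H_sum[OF F(1), of c] by (auto simp: flag_def x Rd_def intro!: sum.neutral)
qed

end

text \<open>A Householder reflection; if the reflected vector already points along the first axis,
  then \<open>v = 0\<close> and the junk value \<open>0 / 0 = 0\<close> makes the map the identity.\<close>

lemma householder_exists:
  assumes "m \<ge> 1" and x0: "x0 \<in> Rd m"
  shows "\<exists>H. linear_isometry_Rd m H \<and> H x0 \<in> Rd 1"
proof -
  define N where "N = vnorm m x0"
  define v where "v = (\<lambda>i. x0 i - (if i = 0 then N else 0))"
  define c where "c = 2 / vinner m v v"
  define H where "H = (\<lambda>x i. x i - c * vinner m v x * v i)"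
  have vR: "v \<in> Rd m" using assms by (auto simp: v_def Rd_def)
  have lin: "vinner m y (\<lambda>i. a * x i + b * z i) = a * vinner m y x + b * vinner m y z" for y a x b z
    by (simp add: vinner_def sum_distrib_left sum.distrib algebra_simps)
  have sym: "vinner m x y = vinner m y x" for x y by (simp add: vinner_def mult.commute)
  have H_eq: "H x = (\<lambda>i. 1 * x i + (- c * vinner m v x) * v i)" for x
    by (simp add: H_def)
  \<comment> \<open>Involution and isometry both reduce to this identity.\<close>
  have cc: "c * c * vinner m v v = 2 * c"
    by (simp add: c_def)
  have vH: "vinner m v (H x) = vinner m v x - c * vinner m v x * vinner m v v" for x
    unfolding H_eq lin by simp
  have "linear_isometry_Rd m H"
  proof
    fix x y :: vec and a b :: real
    show "H x \<in> Rd m" if "x \<in> Rd m" using that vR by (auto simp: H_def Rd_def)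
    show "H (\<lambda>i. a * x i + b * y i) = (\<lambda>i. a * H x i + b * H y i)"
      unfolding H_def lin by (simp add: algebra_simps)
    show "H (H x) = x"
    proof
      fix i
      have "H (H x) i = x i - (2 * c - c * c * vinner m v v) * vinner m v x * v i"
        unfolding fun_cong[OF H_eq[of "H x"], of i] vH fun_cong[OF H_eq[of x], of i]
        by (simp add: algebra_simps)
      then show "H (H x) i = x i" using cc by simp
    qed
    have "vinner m (H x) (H y) = vinner m (H x) y - c * vinner m v y * vinner m (H x) v"
      unfolding H_eq[of y] lin by simp
    also have "vinner m (H x) y = vinner m y (H x)" by (rule sym)
    also have "\<dots> = vinner m y x - c * vinner m v x * vinner m y v"
      unfolding H_eq[of x] lin by simp
    also have "vinner m (H x) v = vinner m v (H x)" by (rule sym)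
    also note vH
    finally have "vinner m (H x) (H y) = vinner m y x - c * vinner m v x * vinner m y v
       - c * vinner m v y * (vinner m v x - c * vinner m v x * vinner m v v)" .
    also have "\<dots> = vinner m y x - (2 * c - c * c * vinner m v v) * vinner m v x * vinner m v y"
      by (simp add: sym[of y v] algebra_simps)
    finally show "vinner m (H x) (H y) = vinner m x y" using cc sym by simp
  qed
  moreover have "H x0 = (\<lambda>i. if i = 0 then N else 0)"
  proof (cases "vinner m v v = 0")
    case True
    then have "vnorm m v = 0" by (simp add: vnorm_def)
    then have "v = (\<lambda>_. 0)" using vnorm_eq_0[OF vR] by simp
    moreover have "H x0 = x0" using True by (simp add: H_def c_def)
    ultimately show ?thesis by (auto simp: v_def fun_eq_iff)
  next
    case False
    have e: "(\<Sum>j<m. (if j = 0 then N else 0) * y j) = N * y 0" for y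
      using assms(1) by (subst sum.mono_neutral_right[of _ "{0}"]) auto
    have NN: "vinner m x0 x0 = N * N"
      using vnorm_sq[of m x0] by (simp add: vinner_def N_def power2_eq_square)
    have vx: "vinner m v y = vinner m x0 y - N * y 0" for y
      using e[of y] by (simp add: vinner_def v_def left_diff_distrib sum_subtractf)
    have x0v: "vinner m x0 v = N * N - N * x0 0" using vx[of x0] sym NN by metis
    \<comment> \<open>Holds because \<open>x0\<close> and its target on the first axis have the same
      norm \<open>N\<close>; it makes \<open>H\<close> subtract exactly \<open>v\<close> from
      \<open>x0\<close>.\<close>
    have "vinner m v v = 2 * vinner m v x0"
      unfolding vx[of v] x0v vx[of x0] NN by (simp add: v_def algebra_simps)
    then have "c * vinner m v x0 = 1" using False by (simp add: c_def)
    then show ?thesis by (auto simp: H_def v_def fun_eq_iff)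
  qed
  then have "H x0 \<in> Rd 1" by (auto simp: Rd_def)
  ultimately show ?thesis by blast
qed

section \<open>Quadratic chains\<close>

definition edge_flow :: "(nat \<Rightarrow> real) \<Rightarrow> vec \<Rightarrow> vec" where
  "edge_flow v y j = v j * (y j - y (Suc j))"

text \<open>The Laplacian of a weighted path, which is the gradient of half of
  \<open>chain_energy\<close> on \<open>Rd m\<close>. Vertex 0 has no edge to its left.\<close>

definition chain_laplacian :: "nat \<Rightarrow> (nat \<Rightarrow> real) \<Rightarrow> vec \<Rightarrow> vec" where
  "chain_laplacian m v y j =
     (if j < m then edge_flow v y j - (if j = 0 then 0 else edge_flow v y (j - 1)) else 0)"

definition chain_energy :: "nat \<Rightarrow> (nat \<Rightarrow> real) \<Rightarrow> vec \<Rightarrow> real" where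
  "chain_energy m v y = (\<Sum>j<m. v j * (y j - y (Suc j))\<^sup>2)"

definition first_axis :: "real \<Rightarrow> vec" where
  "first_axis B = (\<lambda>j. if j = 0 then B else 0)"

text \<open>On \<open>Rd m\<close> the last edge, from \<open>m - 1\<close> to \<open>m\<close>, penalises \<open>y (m - 1)\<close> alone, since
  \<open>y m = 0\<close>.\<close>

definition chain_fun :: "nat \<Rightarrow> real \<Rightarrow> real \<Rightarrow> (nat \<Rightarrow> real) \<Rightarrow> vec \<Rightarrow> real" where
  "chain_fun m \<mu> B v y = \<mu> / 2 * (\<Sum>j<m. (y j - first_axis B j)\<^sup>2) + chain_energy m v y / 2"

definition chain_grad :: "nat \<Rightarrow> real \<Rightarrow> real \<Rightarrow> (nat \<Rightarrow> real) \<Rightarrow> vec \<Rightarrow> vec" where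
  "chain_grad m \<mu> B v y j =
     (if j < m then \<mu> * (y j - first_axis B j) + chain_laplacian m v y j else 0)"

lemma chain_grad_Rd: "chain_grad m \<mu> B v y \<in> Rd m"
  by (simp add: Rd_def chain_grad_def)

lemma chain_energy_nonneg: "(\<And>j. v j \<ge> 0) \<Longrightarrow> chain_energy m v y \<ge> 0"
  unfolding chain_energy_def by (intro sum_nonneg) auto

lemma sum_Suc_le:
  fixes h :: vec
  assumes "h m = 0"
  shows "(\<Sum>j<m. (h (Suc j))\<^sup>2) \<le> (\<Sum>j<m. (h j)\<^sup>2)"
proof -
  have "(h 0)\<^sup>2 + (\<Sum>j<m. (h (Suc j))\<^sup>2) = (\<Sum>j<m. (h j)\<^sup>2) + (h m)\<^sup>2"
    using sum.lessThan_Suc_shift[of "\<lambda>j. (h j)\<^sup>2" m] by simp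
  moreover have "0 \<le> (h 0)\<^sup>2" "(h m)\<^sup>2 = 0" using assms by simp_all
  ultimately show ?thesis by linarith
qed

text \<open>An edge costs at most twice the sum of its squared end values, and a coordinate is an
  end of at most two edges; hence the factor 4.\<close>

lemma chain_energy_le:
  assumes y: "y \<in> Rd m" and v: "\<And>j. 0 \<le> v j" "\<And>j. v j \<le> V"
  shows "chain_energy m v y \<le> 4 * V * (vnorm m y)\<^sup>2"
proof -
  have V: "V \<ge> 0" using v order_trans by blast
  have *: "v j * (y j - y (Suc j))\<^sup>2 \<le> V * (2 * ((y j)\<^sup>2 + (y (Suc j))\<^sup>2))" for j
  proof (intro mult_mono v V)
    have "0 \<le> (y j + y (Suc j))\<^sup>2" by simp
    then show "(y j - y (Suc j))\<^sup>2 \<le> 2 * ((y j)\<^sup>2 + (y (Suc j))\<^sup>2)"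
      unfolding power2_sum power2_diff by simp
  qed simp
  have "chain_energy m v y \<le> (\<Sum>j<m. V * (2 * ((y j)\<^sup>2 + (y (Suc j))\<^sup>2)))"
    unfolding chain_energy_def by (intro sum_mono *)
  also have "\<dots> = 2 * V * ((\<Sum>j<m. (y j)\<^sup>2) + (\<Sum>j<m. (y (Suc j))\<^sup>2))"
    by (simp add: sum_distrib_left sum.distrib[symmetric] algebra_simps)
  also have "\<dots> \<le> 2 * V * ((\<Sum>j<m. (y j)\<^sup>2) + (\<Sum>j<m. (y j)\<^sup>2))"
    using sum_Suc_le[of y m] y V by (intro mult_left_mono add_left_mono) (auto simp: Rd_def)
  finally show ?thesis by (simp add: vnorm_sq)
qed

lemma sum_by_parts:
  fixes h r :: "nat \<Rightarrow> real"
  shows "(\<Sum>j<k. h j * (r j - (if j = 0 then 0 else r (j - 1)))) =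
     (\<Sum>j<k. r j * (h j - h (Suc j))) + (if k = 0 then 0 else r (k - 1) * h k)"
  by (induction k) (auto simp: algebra_simps)

lemma vinner_chain_laplacian:
  assumes "h \<in> Rd m"
  shows "vinner m (chain_laplacian m v y) h =
    (\<Sum>j<m. v j * (y j - y (Suc j)) * (h j - h (Suc j)))"
proof -
  have "vinner m (chain_laplacian m v y) h =
      (\<Sum>j<m. h j * (edge_flow v y j - (if j = 0 then 0 else edge_flow v y (j - 1))))"
    unfolding vinner_def chain_laplacian_def by (intro sum.cong) auto
  also have "\<dots> = (\<Sum>j<m. edge_flow v y j * (h j - h (Suc j)))"
    using assms by (subst sum_by_parts) (auto simp: Rd_def)
  finally show ?thesis by (simp add: edge_flow_def)
qed

lemma vinner_chain_laplacian_self: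
  "y \<in> Rd m \<Longrightarrow> vinner m (chain_laplacian m v y) y = chain_energy m v y"
  by (simp add: vinner_chain_laplacian chain_energy_def power2_eq_square algebra_simps)

text \<open>The function is quadratic, so the second order expansion is exact. Gradient, strong
  convexity and minimality of the proximal point are all read off from it.\<close>

lemma chain_fun_expand:
  assumes h: "h \<in> Rd m"
  shows "chain_fun m \<mu> B v (vadd y h) = chain_fun m \<mu> B v y + vinner m (chain_grad m \<mu> B v y) h
    + \<mu> / 2 * (vnorm m h)\<^sup>2 + chain_energy m v h / 2"
proof -
  have 1: "(\<Sum>j<m. (vadd y h j - first_axis B j)\<^sup>2) =
      (\<Sum>j<m. (y j - first_axis B j)\<^sup>2) + 2 * (\<Sum>j<m. (y j - first_axis B j) * h j) + (\<Sum>j<m. (h j)\<^sup>2)"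
    by (simp add: sum_distrib_left sum.distrib[symmetric] vadd_def power2_eq_square algebra_simps)
  have 2: "chain_energy m v (vadd y h) = chain_energy m v y
      + 2 * vinner m (chain_laplacian m v y) h + chain_energy m v h"
    unfolding vinner_chain_laplacian[OF h]
    by (simp add: chain_energy_def sum_distrib_left sum.distrib[symmetric] vadd_def power2_eq_square algebra_simps)
  have 3: "vinner m (chain_grad m \<mu> B v y) h =
      \<mu> * (\<Sum>j<m. (y j - first_axis B j) * h j) + vinner m (chain_laplacian m v y) h"
    by (simp add: vinner_def chain_grad_def sum_distrib_left sum.distrib[symmetric] algebra_simps)
  show ?thesis unfolding chain_fun_def 1 2 3 vnorm_sq by (simp add: algebra_simps)
qed

lemma chain_grad_diff:
  "vsub (chain_grad m \<mu> B v y) (chain_grad m \<mu> B v z) = chain_grad m \<mu> 0 v (vsub y z)"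
  by (auto simp: vsub_def chain_grad_def chain_laplacian_def edge_flow_def first_axis_def fun_eq_iff algebra_simps)

section \<open>Chains with disjoint edges\<close>

definition matching :: "(nat \<Rightarrow> real) \<Rightarrow> bool" where
  "matching v \<longleftrightarrow> (\<forall>j. v j = 0 \<or> v (Suc j) = 0)"

text \<open>At most one edge at each vertex has weight, so cross terms vanish and every squared flow
  is counted at most twice. Keeping the energy on the right, instead of the norm, lets the bounds of
  all summands be added through their energies.\<close>

lemma vnorm_chain_laplacian_le:
  assumes y: "y \<in> Rd m" and v: "\<And>j. 0 \<le> v j" "\<And>j. v j \<le> V" and mat: "matching v"
  shows "(vnorm m (chain_laplacian m v y))\<^sup>2 \<le> 2 * V * chain_energy m v y"
proof -
  let ?r = "edge_flow v y"
  have prod0: "?r j * ?r (Suc j) = 0" for j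
    using mat by (auto simp: matching_def edge_flow_def)
  have "(vnorm m (chain_laplacian m v y))\<^sup>2 =
      (\<Sum>j<m. (?r j)\<^sup>2 + (if j = 0 then 0 else (?r (j - 1))\<^sup>2))"
    unfolding vnorm_sq
  proof (intro sum.cong refl)
    fix j assume "j \<in> {..<m}"
    then show "(chain_laplacian m v y j)\<^sup>2 = (?r j)\<^sup>2 + (if j = 0 then 0 else (?r (j - 1))\<^sup>2)"
      using prod0[of "j - 1"] by (cases j) (auto simp: chain_laplacian_def power2_diff)
  qed
  also have "\<dots> \<le> 2 * (\<Sum>j<m. (?r j)\<^sup>2)"
  proof (induction m)
    case (Suc m)
    \<comment> \<open>The inequality alone does not carry the induction; the identity with the
      boundary term restored does, and dropping that term gives the bound.\<close>
    have "(\<Sum>j<k. (?r j)\<^sup>2 + (if j = 0 then 0 else (?r (j - 1))\<^sup>2)) + (if k = 0 then 0 else (?r (k - 1))\<^sup>2)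
        = 2 * (\<Sum>j<k. (?r j)\<^sup>2)" for k
      by (induction k) auto
    from this[of "Suc m"] show ?case by (simp add: algebra_simps)
  qed simp
  also have "(\<Sum>j<m. (?r j)\<^sup>2) \<le> (\<Sum>j<m. V * (v j * (y j - y (Suc j))\<^sup>2))"
  proof (rule sum_mono)
    fix j
    have "v j * (v j * (y j - y (Suc j))\<^sup>2) \<le> V * (v j * (y j - y (Suc j))\<^sup>2)"
      by (intro mult_right_mono v mult_nonneg_nonneg) auto
    then show "(?r j)\<^sup>2 \<le> V * (v j * (y j - y (Suc j))\<^sup>2)"
      by (simp add: edge_flow_def power2_eq_square algebra_simps)
  qed
  finally show ?thesis by (simp add: chain_energy_def sum_distrib_left mult.assoc)
qed

lemma vnorm_chain_grad_le:
  assumes y: "y \<in> Rd m" and v: "\<And>j. 0 \<le> v j" "\<And>j. v j \<le> V" and mat: "matching v"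
  shows "(vnorm m (chain_grad m \<mu> 0 v y))\<^sup>2 \<le> \<mu>\<^sup>2 * (vnorm m y)\<^sup>2 + (2 * \<mu> + 2 * V) * chain_energy m v y"
proof -
  have "(vnorm m (chain_grad m \<mu> 0 v y))\<^sup>2 =
      \<mu>\<^sup>2 * (\<Sum>j<m. (y j)\<^sup>2) + 2 * \<mu> * vinner m (chain_laplacian m v y) y
      + (\<Sum>j<m. (chain_laplacian m v y j)\<^sup>2)"
    unfolding vnorm_sq vinner_def sum_distrib_left sum.distrib[symmetric]
    by (intro sum.cong) (auto simp: chain_grad_def first_axis_def power2_eq_square algebra_simps)
  then show ?thesis
    using vnorm_chain_laplacian_le[OF assms] unfolding vinner_chain_laplacian_self[OF y]
    by (simp add: vnorm_sq algebra_simps)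
qed

text \<open>First the regulariser and the proximal penalty are merged into the centre
  \<open>z'\<close> with step \<open>g\<close>. Then each edge is a block \<open>I + a * M\<close>
  with \<open>a = g * v j\<close> and \<open>M * M = 2 * M\<close>, whose inverse is
  \<open>I - a / (1 + 2 * a) * M\<close>. The resolvent is therefore the identity minus a Laplacian
  with weights \<open>v'\<close>.\<close>

definition chain_prox :: "nat \<Rightarrow> real \<Rightarrow> real \<Rightarrow> (nat \<Rightarrow> real) \<Rightarrow> real \<Rightarrow> vec \<Rightarrow> vec" where
  "chain_prox m \<mu> B v \<gamma> z =
    (let g = \<gamma> / (1 + \<gamma> * \<mu>);
         z' = (\<lambda>j. (z j + \<gamma> * \<mu> * first_axis B j) / (1 + \<gamma> * \<mu>));
         v' = (\<lambda>j. g * v j / (1 + (if Suc j < m then 2 else 1) * (g * v j)))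
     in vsub z' (chain_laplacian m v' z'))"

lemma chain_prox_Rd:
  assumes "z \<in> Rd m" "m \<ge> 1"
  shows "chain_prox m \<mu> B v \<gamma> z \<in> Rd m"
  using assms by (auto simp: chain_prox_def Let_def Rd_def vsub_def chain_laplacian_def first_axis_def)

text \<open>Since the edges do not touch, each of them contributes an independent system of two
  equations.\<close>

lemma chain_prox_stationary:
  fixes B :: real
  assumes z: "z \<in> Rd m" and m: "m \<ge> 1" and pos: "\<gamma> > 0" "\<mu> \<ge> 0" and v: "\<And>j. 0 \<le> v j"
    and mat: "matching v"
  defines "u \<equiv> chain_prox m \<mu> B v \<gamma> z"
  shows "vsub z u = (\<lambda>j. \<gamma> * chain_grad m \<mu> B v u j)"
proof -
  define g where "g = \<gamma> / (1 + \<gamma> * \<mu>)"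
  define z' where "z' = (\<lambda>j. (z j + \<gamma> * \<mu> * first_axis B j) / (1 + \<gamma> * \<mu>))"
  define v' where "v' = (\<lambda>j. g * v j / (1 + (if Suc j < m then 2 else 1) * (g * v j)))"
  have u: "u = vsub z' (chain_laplacian m v' z')"
    by (simp add: u_def chain_prox_def Let_def g_def z'_def v'_def)
  have uR: "u \<in> Rd m" unfolding u_def by (rule chain_prox_Rd[OF z m])
  have D: "1 + \<gamma> * \<mu> > 0" using pos by (simp add: add_pos_nonneg)
  have g: "g > 0" using D pos by (simp add: g_def)
  have z'R: "z' \<in> Rd m" using z m by (auto simp: Rd_def z'_def first_axis_def)
  \<comment> \<open>Matching the flow of \<open>z'\<close> under the new weights with the flow of
    \<open>u\<close> under the old ones turns the explicit formula into the implicit equation for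
    \<open>u\<close>.\<close>
  have flow: "edge_flow v' z' j = g * edge_flow v u j" if j: "j < m" for j
  proof (cases "v j = 0")
    case True
    then show ?thesis by (simp add: edge_flow_def v'_def)
  next
    case False
    then have n0: "v (Suc j) = 0" using mat by (auto simp: matching_def)
    have p0: "v (j - 1) = 0" if "j > 0"
      using mat False that unfolding matching_def by (metis Suc_diff_1)
    have gv: "g * v j \<ge> 0" using g v by simp
    have uj: "u j = z' j - edge_flow v' z' j"
      using j p0 by (auto simp: u vsub_def chain_laplacian_def edge_flow_def v'_def)
    show ?thesis
    proof (cases "Suc j < m")
      case True
      have uS: "u (Suc j) = z' (Suc j) + edge_flow v' z' j"
        using True n0 by (auto simp: u vsub_def chain_laplacian_def edge_flow_def v'_def)
      have "edge_flow v' z' j * (1 + 2 * (g * v j)) = g * v j * (z' j - z' (Suc j))"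
        using True gv by (simp add: edge_flow_def v'_def)
      then show ?thesis unfolding edge_flow_def[of v u] uj uS by (simp add: algebra_simps)
    next
      case last: False
      \<comment> \<open>The far end of the last edge lies outside the chain and stays 0. Only one
        end moves, which is why the coefficient is 1 and not 2.\<close>
      have uS: "u (Suc j) = 0" "z' (Suc j) = 0"
        using last uR z'R by (auto simp: Rd_def)
      have "edge_flow v' z' j * (1 + g * v j) = g * v j * z' j"
        using last gv uS by (simp add: edge_flow_def v'_def)
      then show ?thesis unfolding edge_flow_def[of v u] uj uS by (simp add: algebra_simps)
    qed
  qed
  show ?thesis
  proof
    fix j
    show "vsub z u j = \<gamma> * chain_grad m \<mu> B v u j"
    proof (cases "j < m")
      case True
      then have "u j = z' j - g * chain_laplacian m v u j"
        using flow[of j] flow[of "j - 1"]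
        by (auto simp: u[unfolded fun_eq_iff] vsub_def chain_laplacian_def right_diff_distrib)
      then have "(1 + \<gamma> * \<mu>) * u j = (1 + \<gamma> * \<mu>) * z' j - (1 + \<gamma> * \<mu>) * g * chain_laplacian m v u j"
        by (simp only: right_diff_distrib mult.assoc)
      also have "(1 + \<gamma> * \<mu>) * z' j = z j + \<gamma> * \<mu> * first_axis B j" using D by (simp add: z'_def)
      also have "(1 + \<gamma> * \<mu>) * g = \<gamma>" using D by (simp add: g_def)
      finally show ?thesis using True by (simp add: vsub_def chain_grad_def algebra_simps)
    next
      case False
      then show ?thesis using z uR by (simp add: vsub_def chain_grad_def Rd_def)
    qed
  qed
qed

text \<open>At the stationary point the linear terms of the function and of the penalty cancel. The
  quadratic term of the penalty survives as the surplus, and what remains is nonnegative by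
  convexity.\<close>

lemma chain_prox_minimal:
  fixes B :: real
  assumes z: "z \<in> Rd m" and m: "m \<ge> 1" and pos: "\<gamma> > 0" "\<mu> \<ge> 0" and v: "\<And>j. 0 \<le> v j"
    and mat: "matching v" and w: "w \<in> Rd m"
  defines "u \<equiv> chain_prox m \<mu> B v \<gamma> z"
  shows "chain_fun m \<mu> B v w + (vnorm m (vsub z w))\<^sup>2 / (2 * \<gamma>)
    \<ge> chain_fun m \<mu> B v u + (vnorm m (vsub z u))\<^sup>2 / (2 * \<gamma>) + (vnorm m (vsub w u))\<^sup>2 / (2 * \<gamma>)"
proof -
  have uR: "u \<in> Rd m" unfolding u_def by (rule chain_prox_Rd[OF z m])
  define h where "h = vsub w u"
  have hR: "h \<in> Rd m" using uR w by (simp add: h_def vsub_Rd)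
  have wu: "w = vadd u h" by (simp add: h_def vadd_def vsub_def)
  let ?G = "chain_grad m \<mu> B v u"
  have st: "z j - u j = \<gamma> * ?G j" for j
    using chain_prox_stationary[OF z m pos v mat, of B] unfolding u_def[symmetric]
    by (simp add: vsub_def fun_eq_iff)
  have "(vnorm m (vsub z w))\<^sup>2 = (\<Sum>j<m. (\<gamma> * ?G j - h j)\<^sup>2)"
    unfolding vnorm_sq st[symmetric] by (simp add: vsub_def h_def)
  also have "\<dots> = (\<Sum>j<m. (\<gamma> * ?G j)\<^sup>2) - 2 * \<gamma> * vinner m ?G h + (vnorm m h)\<^sup>2"
    unfolding vnorm_sq vinner_def
    by (simp add: power2_diff sum.distrib sum_subtractf sum_distrib_left algebra_simps)
  also have "(\<Sum>j<m. (\<gamma> * ?G j)\<^sup>2) = (vnorm m (vsub z u))\<^sup>2"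
    unfolding vnorm_sq st[symmetric] by (simp add: vsub_def)
  finally have "(vnorm m (vsub z w))\<^sup>2 / (2 * \<gamma>) =
      (vnorm m (vsub z u))\<^sup>2 / (2 * \<gamma>) - vinner m ?G h + (vnorm m h)\<^sup>2 / (2 * \<gamma>)"
    using pos by (simp add: field_simps)
  moreover have "chain_fun m \<mu> B v w \<ge> chain_fun m \<mu> B v u + vinner m ?G h"
    using chain_fun_expand[OF hR, of \<mu> B v u] chain_energy_nonneg[of v m h, OF v] pos
    unfolding wu by (simp add: add_nonneg_nonneg)
  ultimately show ?thesis unfolding h_def by linarith
qed

section \<open>Reach of one gradient or proximal step\<close>

lemma chain_grad_progress:
  assumes "z \<in> Rd k" "k \<ge> 1"
  shows "chain_grad m \<mu> B v z \<in> Rd (Suc k)"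
    and "(\<And>j. v j = 0) \<Longrightarrow> chain_grad m \<mu> B v z \<in> Rd k"
  using assms by (auto simp: Rd_def chain_grad_def chain_laplacian_def edge_flow_def first_axis_def)

text \<open>The closed form applies a single Laplacian, so a proximal step reaches no further than a
  gradient. By \<open>k \<ge> 1\<close> the source at coordinate 0 is already inside.\<close>

lemma chain_prox_progress:
  assumes "z \<in> Rd k" "k \<ge> 1"
  shows "chain_prox m \<mu> B v \<gamma> z \<in> Rd (Suc k)"
    and "(\<And>j. v j = 0) \<Longrightarrow> chain_prox m \<mu> B v \<gamma> z \<in> Rd k"
  using assms by (auto simp: Rd_def chain_prox_def Let_def chain_laplacian_def edge_flow_def first_axis_def vsub_def)

section \<open>The hard instance\<close>

context linear_isometry_Rd
begin

lemma has_grad_pullback: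
  assumes x: "x \<in> Rd m" and v: "\<And>j. 0 \<le> v j" "\<And>j. v j \<le> V" and mu: "\<mu> \<ge> 0"
  shows "has_grad m (\<lambda>x. chain_fun m \<mu> B v (vsub (H x) z0)) x
    (H (chain_grad m \<mu> B v (vsub (H x) z0)))"
proof (rule has_grad_quadraticI)
  let ?G = "chain_grad m \<mu> B v (vsub (H x) z0)"
  show "H ?G \<in> Rd m" by (rule H_Rd[OF chain_grad_Rd])
  fix h assume h: "h \<in> Rd m"
  have e: "vsub (H (vadd x h)) z0 = vadd (vsub (H x) z0) (H h)"
    by (simp add: H_vadd) (simp add: vsub_def vadd_def algebra_simps)
  have i: "vinner m (H ?G) h = vinner m ?G (H h)" by (rule H_adjoint[OF chain_grad_Rd h])
  have nn: "0 \<le> chain_energy m v (H h)" by (rule chain_energy_nonneg[OF v(1)])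
  have le: "chain_energy m v (H h) \<le> 4 * V * (vnorm m h)\<^sup>2"
    using chain_energy_le[OF H_Rd[OF h] v] by (simp add: H_norm[OF h])
  have m: "0 \<le> \<mu> * (vnorm m h)\<^sup>2" using mu by simp
  show "\<bar>chain_fun m \<mu> B v (vsub (H (vadd x h)) z0) - chain_fun m \<mu> B v (vsub (H x) z0)
      - vinner m (H ?G) h\<bar> \<le> (\<mu> / 2 + 2 * V) * (vnorm m h)\<^sup>2"
    unfolding e i chain_fun_expand[OF H_Rd[OF h]] H_norm[OF h] distrib_right using nn le m by simp
qed

lemma prox_pullback:
  assumes x: "x \<in> Rd m" and z0: "z0 \<in> Rd m" and m: "m \<ge> 1" and pos: "\<gamma> > 0" "\<mu> \<ge> 0"
    and v: "\<And>j. 0 \<le> v j" and mat: "matching v"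
  shows "prox m \<gamma> (\<lambda>x. chain_fun m \<mu> B v (vsub (H x) z0)) x
    = H (vadd (chain_prox m \<mu> B v \<gamma> (vsub (H x) z0)) z0)"
proof (rule prox_eqI)
  let ?z = "vsub (H x) z0"
  let ?u = "chain_prox m \<mu> B v \<gamma> ?z"
  have zR: "?z \<in> Rd m" by (intro vsub_Rd H_Rd x z0)
  have uR: "?u \<in> Rd m" by (rule chain_prox_Rd[OF zR m])
  have R: "vadd ?u z0 \<in> Rd m" by (intro vadd_Rd uR z0)
  then show R': "H (vadd ?u z0) \<in> Rd m" by (rule H_Rd)
  have Hu: "H (H (vadd ?u z0)) = vadd ?u z0" by (rule H_inv[OF R])
  have Hu': "vsub (H (H (vadd ?u z0))) z0 = ?u"
    unfolding Hu by (simp add: vsub_def vadd_def)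
  fix w assume w: "w \<in> Rd m"
  have wR: "vsub (H w) z0 \<in> Rd m" by (intro vsub_Rd H_Rd w z0)
  have 1: "vnorm m (vsub x w) = vnorm m (vsub ?z (vsub (H w) z0))"
    using H_norm[OF vsub_Rd[OF x w]] by (simp add: H_vsub) (simp add: vsub_def)
  have 2: "vnorm m (vsub x (H (vadd ?u z0))) = vnorm m (vsub ?z ?u)"
    using H_norm[OF vsub_Rd[OF x R']] by (simp add: H_vsub Hu) (simp add: vsub_def vadd_def algebra_simps)
  have 3: "vnorm m (vsub w (H (vadd ?u z0))) = vnorm m (vsub (vsub (H w) z0) ?u)"
    using H_norm[OF vsub_Rd[OF w R']] by (simp add: H_vsub Hu) (simp add: vsub_def vadd_def algebra_simps)
  show "chain_fun m \<mu> B v (vsub (H (H (vadd ?u z0))) z0)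
      + (vnorm m (vsub x (H (vadd ?u z0))))\<^sup>2 / (2 * \<gamma>)
      + (vnorm m (vsub w (H (vadd ?u z0))))\<^sup>2 / (2 * \<gamma>)
      \<le> chain_fun m \<mu> B v (vsub (H w) z0) + (vnorm m (vsub x w))\<^sup>2 / (2 * \<gamma>)"
    unfolding Hu' 1 2 3 using chain_prox_minimal[OF zR m pos v mat wR] by simp
qed (rule pos)

end

text \<open>\<open>z0\<close> stands for the rotated initial point. \<open>cq\<close> is the
  characteristic equation of the recurrence
  \<open>c * (2 * y j - y (j - 1) - y (j + 1)) = - \<mu> * y j\<close>, with decaying root
  \<open>q\<close>.\<close>

locale hard_instance = linear_isometry_Rd m H for m H +
  fixes z0 :: vec and n a b :: nat and \<mu> B c q :: real
  assumes m_pos: "m \<ge> 1" and z0: "z0 \<in> Rd 1"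
    and ab: "a < n" "b < n" "a \<noteq> b"
    and mu_pos: "\<mu> > 0" and c_pos: "c > 0" and q01: "0 < q" "q < 1"
    and cq: "c * (1 - q)\<^sup>2 = \<mu> * q"
begin

text \<open>The exceptional weight of the last edge makes the truncated geometric sequence \<open>ystar\<close> an
  exact stationary point.\<close>

definition wt :: "nat \<Rightarrow> real" where
  "wt j = (if Suc j < m then 1 else 1 - q)"

text \<open>The factor \<open>n\<close> offsets the averaging. Splitting by parity makes the edges
  of either index disjoint; the other summands are pure regularisers.\<close>

definition cwt :: "nat \<Rightarrow> nat \<Rightarrow> real" where
  "cwt i j = (if i = a \<and> even j \<or> i = b \<and> odd j then real n * c * wt j else 0)"

definition summand :: "nat \<Rightarrow> vec \<Rightarrow> real" where
  "summand i x = chain_fun m \<mu> B (cwt i) (vsub (H x) z0)"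

lemma n_pos: "n > 0" using ab by simp

lemma wt_bounds: "0 \<le> wt j" "wt j \<le> 1"
  using q01 by (auto simp: wt_def)

lemma cwt_bounds: "0 \<le> cwt i j" "cwt i j \<le> real n * c"
  using wt_bounds[of j] c_pos mult_left_le[of "wt j" "real n * c"] by (auto simp: cwt_def)

lemma cwt_matching: "matching (cwt i)"
  using ab by (auto simp: matching_def cwt_def)

lemma cwt_zero: "i \<notin> {a, b} \<Longrightarrow> cwt i j = 0"
  by (simp add: cwt_def)

lemma sum_cwt: "(\<Sum>i<n. cwt i j) = real n * (c * wt j)"
proof (cases "even j")
  case True
  then have "(\<Sum>i<n. cwt i j) = (\<Sum>i<n. if i = a then real n * c * wt j else 0)"
    by (intro sum.cong) (auto simp: cwt_def)
  then show ?thesis using ab by simp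
next
  case False
  then have "(\<Sum>i<n. cwt i j) = (\<Sum>i<n. if i = b then real n * c * wt j else 0)"
    by (intro sum.cong) (auto simp: cwt_def)
  then show ?thesis using ab by simp
qed

lemma z0_Rd: "z0 \<in> Rd m"
  using z0 Rd_mono[OF m_pos] by blast

lemma sum_energy: "(\<Sum>i<n. chain_energy m (cwt i) y) = real n * chain_energy m (\<lambda>j. c * wt j) y"
proof -
  have "(\<Sum>i<n. chain_energy m (cwt i) y) = (\<Sum>j<m. (\<Sum>i<n. cwt i j) * (y j - y (Suc j))\<^sup>2)"
    unfolding chain_energy_def sum_distrib_right by (rule sum.swap)
  then show ?thesis
    unfolding sum_cwt by (simp add: chain_energy_def sum_distrib_left mult.assoc)
qed

lemma favg_summand: "favg n summand = (\<lambda>x. chain_fun m \<mu> B (\<lambda>j. c * wt j) (vsub (H x) z0))"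
proof
  fix x
  let ?y = "vsub (H x) z0"
  have "(\<Sum>i<n. summand i x) = real n * (\<mu> / 2 * (\<Sum>j<m. (?y j - first_axis B j)\<^sup>2))
      + (\<Sum>i<n. chain_energy m (cwt i) ?y) / 2"
    by (simp add: summand_def chain_fun_def sum.distrib sum_divide_distrib)
  then show "favg n summand x = chain_fun m \<mu> B (\<lambda>j. c * wt j) ?y"
    using n_pos unfolding sum_energy by (simp add: favg_def chain_fun_def field_simps)
qed

lemma summand_has_grad:
  "x \<in> Rd m \<Longrightarrow> has_grad m (summand i) x (H (chain_grad m \<mu> B (cwt i) (vsub (H x) z0)))"
  unfolding summand_def[abs_def] using mu_pos by (intro has_grad_pullback[OF _ cwt_bounds]) auto

lemma favg_has_grad:
  "x \<in> Rd m \<Longrightarrow> has_grad m (favg n summand) x (H (chain_grad m \<mu> B (\<lambda>j. c * wt j) (vsub (H x) z0)))"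
  unfolding favg_summand using mu_pos c_pos wt_bounds
  by (intro has_grad_pullback[where V = c]) (auto simp: mult_left_le)

text \<open>Each gradient difference is bounded by the energy of its own summand. These energies add
  up to \<open>n\<close> times that of the averaged chain, whose weights are at most
  \<open>c\<close> instead of \<open>n * c\<close>, so the coupling enters only as
  \<open>8 * n * c\<^sup>2\<close>.\<close>

lemma summand_avg_smooth:
  assumes L: "\<mu>\<^sup>2 + 8 * \<mu> * c + 8 * real n * c\<^sup>2 \<le> L\<^sup>2"
  shows "avg_smooth m n L summand"
  unfolding avg_smooth_def
proof (intro conjI ballI allI impI)
  fix i show "differentiable_Rd m (summand i)"
    unfolding differentiable_Rd_def using summand_has_grad by blast
next
  fix x y assume x: "x \<in> Rd m" and y: "y \<in> Rd m"
  define h where "h = H (vsub x y)"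
  have hR: "h \<in> Rd m" using x y by (simp add: h_def H_Rd vsub_Rd)
  have hn: "vnorm m h = vnorm m (vsub x y)" using x y by (simp add: h_def H_norm vsub_Rd)
  have heq: "vsub (vsub (H x) z0) (vsub (H y) z0) = h"
    by (simp add: h_def H_vsub) (simp add: vsub_def)
  have gr: "vnorm m (vsub (grad m (summand i) x) (grad m (summand i) y)) = vnorm m (chain_grad m \<mu> 0 (cwt i) h)" for i
    unfolding grad_eqI[OF summand_has_grad[OF x]] grad_eqI[OF summand_has_grad[OF y]]
      H_vsub[symmetric] chain_grad_diff heq
    by (rule H_norm[OF chain_grad_Rd])
  have "(\<Sum>i<n. (vnorm m (chain_grad m \<mu> 0 (cwt i) h))\<^sup>2)
      \<le> (\<Sum>i<n. \<mu>\<^sup>2 * (vnorm m h)\<^sup>2 + (2 * \<mu> + 2 * (real n * c)) * chain_energy m (cwt i) h)"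
    by (intro sum_mono vnorm_chain_grad_le[OF hR cwt_bounds cwt_matching])
  also have "\<dots> = real n * (\<mu>\<^sup>2 * (vnorm m h)\<^sup>2)
      + (2 * \<mu> + 2 * (real n * c)) * (real n * chain_energy m (\<lambda>j. c * wt j) h)"
    by (simp add: sum.distrib sum_distrib_left[symmetric] sum_energy)
  also have "\<dots> \<le> real n * (\<mu>\<^sup>2 * (vnorm m h)\<^sup>2)
      + (2 * \<mu> + 2 * (real n * c)) * (real n * (4 * c * (vnorm m h)\<^sup>2))"
    using mu_pos c_pos wt_bounds
    by (intro add_left_mono mult_left_mono chain_energy_le[OF hR]) (auto simp: mult_left_le)
  also have "\<dots> = real n * ((\<mu>\<^sup>2 + 8 * \<mu> * c + 8 * real n * c\<^sup>2) * (vnorm m h)\<^sup>2)"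
    by (simp add: power2_eq_square algebra_simps)
  also have "\<dots> \<le> real n * (L\<^sup>2 * (vnorm m h)\<^sup>2)"
    using L by (intro mult_left_mono mult_right_mono) auto
  finally show "1 / real n * (\<Sum>i<n. (vnorm m (vsub (grad m (summand i) x) (grad m (summand i) y)))\<^sup>2)
      \<le> L\<^sup>2 * (vnorm m (vsub x y))\<^sup>2"
    unfolding gr hn using n_pos by (simp add: field_simps)
qed

lemma favg_quadratic_lower_bound:
  assumes x: "x \<in> Rd m" and y: "y \<in> Rd m"
  shows "favg n summand y \<ge> favg n summand x + vinner m (grad m (favg n summand) x) (vsub y x)
      + \<mu> / 2 * (vnorm m (vsub y x))\<^sup>2"
proof -
  define h where "h = H (vsub y x)"
  have hR: "h \<in> Rd m" using x y by (simp add: h_def H_Rd vsub_Rd)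
  have hn: "vnorm m h = vnorm m (vsub y x)" using x y by (simp add: h_def H_norm vsub_Rd)
  have yx: "vsub (H y) z0 = vadd (vsub (H x) z0) h"
    by (simp add: h_def H_vsub) (simp add: vsub_def vadd_def)
  have nn: "chain_energy m (\<lambda>j. c * wt j) h \<ge> 0"
    using c_pos wt_bounds by (intro chain_energy_nonneg) auto
  show ?thesis
    unfolding grad_eqI[OF favg_has_grad[OF x]] H_adjoint[OF chain_grad_Rd vsub_Rd[OF y x]]
      h_def[symmetric] hn[symmetric]
    unfolding favg_summand yx chain_fun_expand[OF hR] using nn by simp
qed

lemma favg_strongly_convex: "strongly_convex_Rd m \<mu> (favg n summand)"
  unfolding strongly_convex_Rd_def differentiable_Rd_def
  using favg_has_grad favg_quadratic_lower_bound by blast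

section \<open>The minimiser and the two gaps\<close>

definition ystar :: vec where
  "ystar j = (if j < m then B * (1 - q) * q ^ j else 0)"

definition xstar :: vec where
  "xstar = H (vadd ystar z0)"

lemma ystar_Rd: "ystar \<in> Rd m"
  by (simp add: Rd_def ystar_def)

lemma xstar_Rd: "xstar \<in> Rd m"
  unfolding xstar_def by (intro H_Rd vadd_Rd ystar_Rd z0_Rd)

lemma H_xstar: "H xstar = vadd ystar z0"
  unfolding xstar_def by (intro H_inv vadd_Rd ystar_Rd z0_Rd)

lemma ystar_flow: "j < m \<Longrightarrow> edge_flow (\<lambda>j. c * wt j) ystar j = c * (1 - q) * (B * (1 - q) * q ^ j)"
  by (auto simp: edge_flow_def ystar_def wt_def algebra_simps)

lemma ystar_stationary: "chain_grad m \<mu> B (\<lambda>j. c * wt j) ystar = (\<lambda>_. 0)"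
proof
  fix j
  show "chain_grad m \<mu> B (\<lambda>j. c * wt j) ystar j = 0"
  proof (cases j)
    case 0
    \<comment> \<open>With no edge to the left of vertex 0, the equation there reduces to
      \<open>cq\<close> just like the later ones.\<close>
    have "chain_grad m \<mu> B (\<lambda>j. c * wt j) ystar 0 = B * (c * (1 - q)\<^sup>2 - \<mu> * q)"
      using m_pos ystar_flow[of 0]
      by (simp add: chain_grad_def chain_laplacian_def first_axis_def ystar_def power2_eq_square algebra_simps)
    then show ?thesis using cq 0 by simp
  next
    case (Suc k)
    show ?thesis
    proof (cases "j < m")
      case True
      then have "chain_grad m \<mu> B (\<lambda>j. c * wt j) ystar j
          = B * (1 - q) * q ^ k * (\<mu> * q - c * (1 - q)\<^sup>2)"
        using Suc ystar_flow[of j] ystar_flow[of k]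
        by (simp add: chain_grad_def chain_laplacian_def first_axis_def ystar_def power2_eq_square algebra_simps)
      then show ?thesis using cq by simp
    qed (simp add: chain_grad_def)
  qed
qed

lemma grad_xstar: "grad m (favg n summand) xstar = (\<lambda>_. 0)"
proof -
  have "vsub (H xstar) z0 = ystar" unfolding H_xstar by (simp add: vsub_def vadd_def)
  then show ?thesis
    using grad_eqI[OF favg_has_grad[OF xstar_Rd]] by (simp add: ystar_stationary H_zero)
qed

lemma favg_growth:
  assumes "x \<in> Rd m"
  shows "favg n summand x \<ge> favg n summand xstar + \<mu> / 2 * (vnorm m (vsub x xstar))\<^sup>2"
  using favg_quadratic_lower_bound[OF xstar_Rd assms] by (simp add: grad_xstar vinner_def)

lemma xstar_minimal: "x \<in> Rd m \<Longrightarrow> favg n summand xstar \<le> favg n summand x"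
  using favg_growth[of x] mu_pos by (smt (verit) mult_nonneg_nonneg zero_le_power2 half_gt_zero)

text \<open>Stationarity expresses the energy of \<open>ystar\<close> by inner products; then the
  squares of \<open>ystar\<close> cancel and only \<open>ystar 0 * B\<close> is left.\<close>

lemma favg_initial_gap:
  assumes "H x = z0"
  shows "favg n summand x - favg n summand xstar = \<mu> / 2 * B\<^sup>2 * (1 - q)"
proof -
  let ?w = "\<lambda>j. c * wt j"
  have e1: "vsub (H x) z0 = (\<lambda>_. 0)" unfolding assms by (simp add: vsub_def)
  have e2: "vsub (H xstar) z0 = ystar" unfolding H_xstar by (simp add: vsub_def vadd_def)
  have org: "(\<Sum>j<m. f j * first_axis B j) = f 0 * B" for f
    using m_pos by (subst sum.mono_neutral_right[of _ "{0}"]) (auto simp: first_axis_def)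
  have org2: "(\<Sum>j<m. (first_axis B j)\<^sup>2) = B\<^sup>2"
    using org[of "first_axis B"] by (simp add: power2_eq_square first_axis_def)
  have lap: "chain_laplacian m ?w ystar j = - \<mu> * (ystar j - first_axis B j)" if "j < m" for j
    using fun_cong[OF ystar_stationary, of j] that by (simp add: chain_grad_def)
  have "chain_energy m ?w ystar = vinner m (chain_laplacian m ?w ystar) ystar"
    by (rule vinner_chain_laplacian_self[OF ystar_Rd, symmetric])
  also have "\<dots> = (\<Sum>j<m. \<mu> * (ystar j * first_axis B j) - \<mu> * (ystar j)\<^sup>2)"
    unfolding vinner_def by (intro sum.cong) (auto simp: lap power2_eq_square algebra_simps)
  also have "\<dots> = \<mu> * (ystar 0 * B) - \<mu> * (\<Sum>j<m. (ystar j)\<^sup>2)"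
    by (simp add: sum_subtractf sum_distrib_left[symmetric] org)
  finally have en: "chain_energy m ?w ystar = \<mu> * (ystar 0 * B) - \<mu> * (\<Sum>j<m. (ystar j)\<^sup>2)" .
  have sq: "(\<Sum>j<m. (ystar j - first_axis B j)\<^sup>2) = (\<Sum>j<m. (ystar j)\<^sup>2) - 2 * (ystar 0 * B) + B\<^sup>2"
    unfolding power2_diff sum.distrib sum_subtractf org2
    using org[of ystar] by (simp add: sum_distrib_left[symmetric] mult.assoc)
  have z: "chain_energy m ?w (\<lambda>_. 0) = 0" by (simp add: chain_energy_def)
  have y0: "ystar 0 = B * (1 - q)" using m_pos by (simp add: ystar_def)
  show ?thesis
    unfolding favg_summand e1 e2 chain_fun_def en sq z y0 using org2
    by (simp add: power2_eq_square field_simps)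
qed

text \<open>The rotated point vanishes at coordinates \<open>k\<close> to \<open>m - 1\<close>, so
  its distance to the minimiser contains the tail of the geometric sequence, and
  \<open>favg_growth\<close> turns distance into a gap. The initial gap factors out because
  \<open>(1 - q)\<^sup>2 / (1 - q\<^sup>2) = (1 - q) / (1 + q)\<close>.\<close>

lemma favg_gap_on_flag:
  assumes x: "x \<in> flag k" and k: "k \<ge> 1"
  shows "favg n summand x - favg n summand xstar
    \<ge> \<mu> / 2 * B\<^sup>2 * (1 - q) * ((q\<^sup>2 ^ k - q\<^sup>2 ^ m) / (1 + q))"
proof -
  have xR: "x \<in> Rd m" and Hx: "H x \<in> Rd k" using x by (auto simp: flag_def)
  have q2: "q\<^sup>2 < 1" using q01 by (simp add: power_less_one_iff)
  \<comment> \<open>Only an inequality is claimed, as \<open>k\<close> may exceed \<open>m\<close>: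
    then the sum is empty and the left side is not positive.\<close>
  have "(q\<^sup>2 ^ k - q\<^sup>2 ^ m) / (1 - q\<^sup>2) \<le> (\<Sum>j\<in>{k..<m}. q\<^sup>2 ^ j)"
  proof (cases "k \<le> m")
    case True
    then have "(\<Sum>j\<in>{k..<m}. r ^ j) * (1 - r) = r ^ k - r ^ m" for r :: real
    proof (induction m rule: dec_induct)
      case (step i)
      have "(\<Sum>j\<in>{k..<Suc i}. r ^ j) * (1 - r) = (\<Sum>j\<in>{k..<i}. r ^ j) * (1 - r) + r ^ i * (1 - r)"
        using step by (simp add: distrib_right)
      then show ?case unfolding step.IH by (simp add: algebra_simps)
    qed simp
    from this[of "q\<^sup>2"] have "(\<Sum>j\<in>{k..<m}. q\<^sup>2 ^ j) * (1 - q\<^sup>2) = q\<^sup>2 ^ k - q\<^sup>2 ^ m" .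
    then show ?thesis using q2 by (simp add: field_simps)
  next
    case False
    then have "q\<^sup>2 ^ k \<le> q\<^sup>2 ^ m" using q2 by (intro power_decreasing) auto
    then show ?thesis using q2 False by (simp add: divide_nonpos_pos)
  qed
  then have "(B * (1 - q))\<^sup>2 * ((q\<^sup>2 ^ k - q\<^sup>2 ^ m) / (1 - q\<^sup>2)) \<le> (B * (1 - q))\<^sup>2 * (\<Sum>j\<in>{k..<m}. q\<^sup>2 ^ j)"
    by (intro mult_left_mono) auto
  also have "\<dots> = (\<Sum>j\<in>{k..<m}. (vsub (H x) (H xstar) j)\<^sup>2)"
    unfolding sum_distrib_left
  proof (intro sum.cong refl)
    fix j assume j: "j \<in> {k..<m}"
    then have "H x j = 0" "z0 j = 0" using Hx z0 k by (auto simp: Rd_def)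
    then have "vsub (H x) (H xstar) j = - (B * (1 - q) * q ^ j)"
      using j by (simp add: vsub_def H_xstar vadd_def ystar_def)
    then show "(B * (1 - q))\<^sup>2 * q\<^sup>2 ^ j = (vsub (H x) (H xstar) j)\<^sup>2"
      by (simp add: power_mult_distrib power_mult[symmetric] mult.commute)
  qed
  also have "\<dots> \<le> (\<Sum>j<m. (vsub (H x) (H xstar) j)\<^sup>2)"
    by (intro sum_mono2) auto
  also have "\<dots> = (vnorm m (vsub x xstar))\<^sup>2"
    unfolding vnorm_sq[symmetric] H_vsub[symmetric] by (simp add: H_norm vsub_Rd xR xstar_Rd)
  finally have "\<mu> / 2 * ((B * (1 - q))\<^sup>2 * ((q\<^sup>2 ^ k - q\<^sup>2 ^ m) / (1 - q\<^sup>2)))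
      \<le> favg n summand x - favg n summand xstar"
    using favg_growth[OF xR] mu_pos
    by (smt (verit, best) mult_left_mono half_gt_zero)
  moreover have "(B * (1 - q))\<^sup>2 * ((q\<^sup>2 ^ k - q\<^sup>2 ^ m) / (1 - q\<^sup>2))
      = B\<^sup>2 * (1 - q) * ((q\<^sup>2 ^ k - q\<^sup>2 ^ m) / (1 + q))"
  proof -
    have "1 - q\<^sup>2 = (1 - q) * (1 + q)" by (simp add: power2_eq_square algebra_simps)
    then show ?thesis using q01 by (simp add: power2_eq_square)
  qed
  ultimately show ?thesis by (simp only: mult.assoc)
qed

lemma flag_progress:
  assumes x: "x \<in> flag k" and k: "k \<ge> 1" and \<gamma>: "\<gamma> > 0"
  shows "grad m (summand i) x \<in> flag (k + (if i \<in> {a, b} then 1 else 0))"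
    and "prox m \<gamma> (summand i) x \<in> flag (k + (if i \<in> {a, b} then 1 else 0))"
proof -
  have xR: "x \<in> Rd m" and Hx: "H x \<in> Rd k" using x by (auto simp: flag_def)
  let ?z = "vsub (H x) z0" and ?k = "k + (if i \<in> {a, b} then 1 else 0)"
  have z0k: "z0 \<in> Rd k" using z0 Rd_mono[OF k] by blast
  have zk: "?z \<in> Rd k" by (intro vsub_Rd Hx z0k)
  have zR: "?z \<in> Rd m" by (intro vsub_Rd H_Rd xR z0_Rd)
  have g: "chain_grad m \<mu> B (cwt i) ?z \<in> Rd ?k" "chain_prox m \<mu> B (cwt i) \<gamma> ?z \<in> Rd ?k"
    using chain_grad_progress[OF zk k, where v = "cwt i"] chain_prox_progress[OF zk k, where v = "cwt i"]
      cwt_zero[of i] by (auto split: if_splits)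
  show "grad m (summand i) x \<in> flag ?k"
    unfolding grad_eqI[OF summand_has_grad[OF xR]] flag_def
    using g(1) by (simp add: H_Rd H_inv chain_grad_Rd)
  have u: "vadd (chain_prox m \<mu> B (cwt i) \<gamma> ?z) z0 \<in> Rd m"
    by (intro vadd_Rd chain_prox_Rd zR m_pos z0_Rd)
  have p: "prox m \<gamma> (summand i) x = H (vadd (chain_prox m \<mu> B (cwt i) \<gamma> ?z) z0)"
    unfolding summand_def[abs_def] using mu_pos
    by (intro prox_pullback xR z0_Rd m_pos \<gamma> cwt_bounds cwt_matching) auto
  have "z0 \<in> Rd ?k" using z0k Rd_mono[of k ?k] by auto
  then have "vadd (chain_prox m \<mu> B (cwt i) \<gamma> ?z) z0 \<in> Rd ?k" by (intro vadd_Rd g)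
  then show "prox m \<gamma> (summand i) x \<in> flag ?k"
    unfolding p flag_def using u by (simp add: H_Rd H_inv)
qed

end

section \<open>Progress of the algorithm\<close>

lemma pifo_hist_Suc:
  "pifo_hist d f gam x0 upd om (Suc t) = pifo_hist d f gam x0 upd om t @
    [(om (Suc t), f (om (Suc t)) (pifo_iter d f gam x0 upd om t),
      grad d (f (om (Suc t))) (pifo_iter d f gam x0 upd om t),
      prox d (gam (Suc t)) (f (om (Suc t))) (pifo_iter d f gam x0 upd om t))]"
  by (simp add: Let_def pifo_iter_def)

lemma card_hits_Suc:
  "card {s \<in> {1..Suc t}. om s \<in> S} = card {s \<in> {1..t}. om s \<in> S} + (if om (Suc t) \<in> S then 1 else 0)"
proof -
  have "{s \<in> {1..Suc t}. om s \<in> S} =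
      (if om (Suc t) \<in> S then insert (Suc t) {s \<in> {1..t}. om s \<in> S} else {s \<in> {1..t}. om s \<in> S})"
    by (auto simp: le_Suc_eq)
  then show ?thesis by simp
qed

context hard_instance
begin

lemma pifo_iter_flag:
  assumes alg: "pifo_alg n m P gam x0 upd" and om: "\<And>s. om s < n" and x0: "x0 \<in> flag 1"
  shows "pifo_iter m summand gam x0 upd om t \<in> flag (1 + card {s \<in> {1..t}. om s \<in> {a, b}})"
proof -
  let ?N = "\<lambda>t. card {s \<in> {1..t}. om s \<in> {a, b}}"
  let ?x = "pifo_iter m summand gam x0 upd om" and ?h = "pifo_hist m summand gam x0 upd om"
  have span: "\<forall>om t. (\<forall>s. om s < n) \<longrightarrow> t \<ge> 1 \<longrightarrow> pifo_iter m summand gam x0 upd om t \<in>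
      vspan ({pifo_iter m summand gam x0 upd om s | s. s < t}
        \<union> {fst (snd (snd ob)) | ob. ob \<in> set (pifo_hist m summand gam x0 upd om t)}
        \<union> {snd (snd (snd ob)) | ob. ob \<in> set (pifo_hist m summand gam x0 upd om t)})"
    using alg unfolding pifo_alg_def by blast
  \<comment> \<open>The next iterate is spanned by all earlier iterates and observations, so the
    invariant has to cover these too.\<close>
  have "(\<forall>s\<le>t. ?x s \<in> flag (1 + ?N t)) \<and>
    (\<forall>ob \<in> set (?h t). fst (snd (snd ob)) \<in> flag (1 + ?N t) \<and> snd (snd (snd ob)) \<in> flag (1 + ?N t))"
  proof (induction t)
    case 0
    then show ?case using x0 by (simp add: pifo_iter_def)
  next
    case (Suc t)
    let ?K = "1 + ?N (Suc t)"
    have K: "?K = (1 + ?N t) + (if om (Suc t) \<in> {a, b} then 1 else 0)"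
      unfolding card_hits_Suc by simp
    have sub: "flag (1 + ?N t) \<subseteq> flag ?K" unfolding K by (rule flag_mono) simp
    have gam: "gam (Suc t) > 0" using alg by (simp add: pifo_alg_def)
    have xt: "?x t \<in> flag (1 + ?N t)" using Suc by blast
    have new: "grad m (summand (om (Suc t))) (?x t) \<in> flag ?K"
       "prox m (gam (Suc t)) (summand (om (Suc t))) (?x t) \<in> flag ?K"
      unfolding K by (intro flag_progress[OF xt _ gam]; simp)+
    have obs: "fst (snd (snd ob)) \<in> flag ?K \<and> snd (snd (snd ob)) \<in> flag ?K"
      if "ob \<in> set (?h (Suc t))" for ob
      using that Suc sub new unfolding pifo_hist_Suc by auto
    have old: "?x s \<in> flag ?K" if "s \<le> t" for s using Suc sub that by blast
    have "?x (Suc t) \<in> vspan ({?x s | s. s < Suc t}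
                 \<union> {fst (snd (snd ob)) | ob. ob \<in> set (?h (Suc t))}
                 \<union> {snd (snd (snd ob)) | ob. ob \<in> set (?h (Suc t))})"
      using om by (intro span[rule_format]) auto
    moreover have "\<dots> \<subseteq> flag ?K"
      using obs old by (intro vspan_flag) auto
    ultimately have "?x (Suc t) \<in> flag ?K" by blast
    then show ?case using obs old by (auto simp: le_Suc_eq)
  qed
  then show ?thesis by simp
qed

end

text \<open>Independence makes the expectation a \<open>t\<close>-th power, and convexity of
  \<open>exp\<close> bounds its base below by \<open>\<rho>\<close> raised to the hitting
  probability. The upper bound \<open>p\<close> may replace that probability since
  \<open>ln \<rho> \<le> 0\<close>.\<close>

lemma expectation_power_hits:
  fixes P :: "nat pmf" and \<rho> :: real
  assumes fin: "finite (set_pmf P)" and \<rho>: "0 < \<rho>" "\<rho> \<le> 1"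
    and p: "measure_pmf.prob P S \<le> p"
  shows "measure_pmf.expectation (Pi_pmf {1..t} 0 (\<lambda>_. P)) (\<lambda>om. \<rho> ^ card {s \<in> {1..t}. om s \<in> S})
    \<ge> exp (p * real t * ln \<rho>)"
proof -
  let ?p = "measure_pmf.prob P S"
  have "\<rho> ^ card {s \<in> {1..t}. om s \<in> S} = (\<Prod>s\<in>{1..t}. if om s \<in> S then \<rho> else 1)" for om
    by (simp add: prod.If_cases Int_def)
  then have "measure_pmf.expectation (Pi_pmf {1..t} 0 (\<lambda>_. P)) (\<lambda>om. \<rho> ^ card {s \<in> {1..t}. om s \<in> S})
      = measure_pmf.expectation (Pi_pmf {1..t} 0 (\<lambda>_. P)) (\<lambda>om. \<Prod>s\<in>{1..t}. if om s \<in> S then \<rho> else 1)"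
    by simp
  also have "\<dots> = (\<Prod>s\<in>{1..t}. measure_pmf.expectation P (\<lambda>i. if i \<in> S then \<rho> else 1))"
    using \<rho> by (subst expectation_prod_Pi_pmf) (auto intro: integrable_measure_pmf_finite[OF fin])
  also have "\<dots> = (measure_pmf.expectation P (\<lambda>i. if i \<in> S then \<rho> else 1)) ^ t"
    by simp
  also have "(\<lambda>i. if i \<in> S then \<rho> else 1) = (\<lambda>i. 1 + (\<rho> - 1) * indicator S i)"
    by (auto simp: indicator_def)
  also have "measure_pmf.expectation P (\<lambda>i. 1 + (\<rho> - 1) * indicator S i) = 1 + (\<rho> - 1) * ?p"
    by (subst Bochner_Integration.integral_add)
      (auto intro: integrable_measure_pmf_finite[OF fin])
  finally have eq: "measure_pmf.expectation (Pi_pmf {1..t} 0 (\<lambda>_. P))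
      (\<lambda>om. \<rho> ^ card {s \<in> {1..t}. om s \<in> S}) = (1 + (\<rho> - 1) * ?p) ^ t" .
  have p01: "0 \<le> ?p" "?p \<le> 1" by auto
  have "exp ((1 - ?p) *\<^sub>R 0 + ?p *\<^sub>R ln \<rho>) \<le> (1 - ?p) * exp 0 + ?p * exp (ln \<rho>)"
    by (rule convex_onD[OF exp_convex p01]) auto
  then have "exp (?p * ln \<rho>) \<le> 1 + (\<rho> - 1) * ?p" using \<rho> by (simp add: algebra_simps)
  then have "exp (?p * ln \<rho>) ^ t \<le> (1 + (\<rho> - 1) * ?p) ^ t" by (intro power_mono) auto
  moreover have "exp (?p * ln \<rho>) ^ t = exp (?p * real t * ln \<rho>)"
    by (simp add: exp_of_nat_mult[symmetric] algebra_simps)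
  moreover have "exp (p * real t * ln \<rho>) \<le> exp (?p * real t * ln \<rho>)"
    unfolding exp_le_cancel_iff using p \<rho> by (intro mult_right_mono_neg mult_right_mono) auto
  ultimately show ?thesis unfolding eq by linarith
qed

section \<open>A rarely drawn pair of indices\<close>

lemma exists_le_average:
  fixes p :: "nat \<Rightarrow> real"
  assumes "finite A" "A \<noteq> {}" "sum p A \<le> 1"
  shows "\<exists>i\<in>A. p i \<le> 1 / real (card A)"
proof (rule ccontr)
  assume "\<not> ?thesis"
  then have "(\<Sum>i\<in>A. 1 / real (card A)) < sum p A"
    using assms by (intro sum_strict_mono) auto
  then show False using assms by simp
qed

text \<open>Some index has probability at most \<open>1 / n\<close>, and some other one at most
  \<open>1 / (n - 1)\<close>, which is at most \<open>2 / n\<close> for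
  \<open>n \<ge> 2\<close>.\<close>

lemma exists_rare_pair:
  assumes n: "n \<ge> 2"
  shows "\<exists>a b. a < n \<and> b < n \<and> a \<noteq> b \<and> measure_pmf.prob P {a, b} \<le> 3 / real n"
proof -
  have le1: "sum (pmf P) A \<le> 1" if "finite A" for A
    using measure_measure_pmf_finite[OF that, of P] by (metis measure_pmf.prob_le_1)
  have "{..<n} \<noteq> {}" using n by (auto simp: lessThan_empty_iff)
  then obtain a where a: "a < n" "pmf P a \<le> 1 / real n"
    using exists_le_average[of "{..<n}" "pmf P"] le1 by auto
  have c: "card ({..<n} - {a}) = n - 1" using a by simp
  then have "{..<n} - {a} \<noteq> {}" using n by (metis card.empty diff_is_0_eq Suc_1 not_less_eq_eq)
  then obtain b where b: "b < n" "b \<noteq> a" "pmf P b \<le> 1 / real (n - 1)"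
    using exists_le_average[of "{..<n} - {a}" "pmf P"] le1 c by auto
  have "1 / real (n - 1) \<le> 2 / real n" using n by (simp add: field_simps of_nat_diff)
  moreover have "1 / real n + 2 / real n = 3 / real n" by (simp add: add_divide_distrib[symmetric])
  ultimately have "pmf P a + pmf P b \<le> 3 / real n" using a b by linarith
  moreover have "measure_pmf.prob P {a, b} = pmf P a + pmf P b"
    using b by (subst measure_measure_pmf_finite) auto
  ultimately show ?thesis using a b by (intro exI[of _ a] exI[of _ b]) auto
qed

section \<open>Lower bound on the expected gap\<close>

context hard_instance
begin

text \<open>The gap at flag index \<open>1 + N\<close> is averaged over the draws; the leading 1
  becomes the separate factor \<open>q\<^sup>2\<close>. The draws have finite support, so every
  integrand is integrable.\<close>

lemma pifo_expect_lower_bound: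
  assumes alg: "pifo_alg n m P gam x0 upd" and x0: "H x0 = z0"
    and ab_rare: "measure_pmf.prob P {a, b} \<le> p"
  shows "pifo_expect m summand P gam x0 upd (favg n summand) t - favg n summand xstar
    \<ge> \<mu> / 2 * B\<^sup>2 * (1 - q) * ((q\<^sup>2 * exp (2 * p * real t * ln q) - q\<^sup>2 ^ m) / (1 + q))"
proof -
  let ?M = "Pi_pmf {1..t} 0 (\<lambda>_. P)"
  let ?N = "\<lambda>om. card {s \<in> {1..t}. om s \<in> {a, b}}"
  define D where "D = \<mu> / 2 * B\<^sup>2 * (1 - q) / (1 + q)"
  have D: "D \<ge> 0" using mu_pos q01 by (simp add: D_def)
  have Psub: "set_pmf P \<subseteq> {..<n}" using alg by (simp add: pifo_alg_def)
  then have fin: "finite (set_pmf P)" by (rule finite_subset) simp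
  have supp: "set_pmf ?M = PiE_dflt {1..t} 0 (\<lambda>_. set_pmf P)"
    by (subst set_Pi_pmf) (auto simp: o_def)
  have finM: "finite (set_pmf ?M)" unfolding supp using fin by (intro finite_PiE_dflt) auto
  note int = integrable_measure_pmf_finite[OF finM]
  have x0R: "x0 \<in> Rd m" using alg by (simp add: pifo_alg_def)
  have x0f: "x0 \<in> flag 1" using x0R x0 z0 by (simp add: flag_def)
  have affine: "measure_pmf.expectation M (\<lambda>om. A + D * (k * X om - r))
      = A + D * (k * measure_pmf.expectation M X - r)"
    if "finite (set_pmf M)" for M :: "(nat \<Rightarrow> nat) pmf" and X and A D k r :: real
    by (simp add: integrable_measure_pmf_finite[OF that])
  have pt: "favg n summand xstar + D * (q\<^sup>2 * (q\<^sup>2) ^ ?N om - q\<^sup>2 ^ m)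
      \<le> favg n summand (pifo_iter m summand gam x0 upd om t)" if "om \<in> set_pmf ?M" for om
  proof -
    \<comment> \<open>Outside \<open>{1..t}\<close> the draws take the default value 0, a valid
      index because \<open>n > 0\<close>.\<close>
    have "om s < n" for s
      using that Psub n_pos unfolding supp PiE_dflt_def by (cases "s \<in> {1..t}") auto
    from favg_gap_on_flag[OF pifo_iter_flag[of P gam x0 upd om t, OF alg this x0f]]
    show ?thesis by (simp add: D_def)
  qed
  have "favg n summand xstar + D * (q\<^sup>2 * exp (2 * p * real t * ln q) - q\<^sup>2 ^ m)
     \<le> favg n summand xstar + D * (q\<^sup>2 * measure_pmf.expectation ?M (\<lambda>om. (q\<^sup>2) ^ ?N om) - q\<^sup>2 ^ m)"
  proof (intro add_left_mono mult_left_mono diff_right_mono D)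
    have "exp (2 * p * real t * ln q) = exp (p * real t * ln (q\<^sup>2))"
      using q01 by (simp add: ln_realpow algebra_simps)
    also have "\<dots> \<le> measure_pmf.expectation ?M (\<lambda>om. (q\<^sup>2) ^ ?N om)"
      using q01 by (intro expectation_power_hits[OF fin _ _ ab_rare]) (auto simp: power_le_one)
    finally show "exp (2 * p * real t * ln q) \<le> measure_pmf.expectation ?M (\<lambda>om. (q\<^sup>2) ^ ?N om)" .
  qed simp
  also have "\<dots> = measure_pmf.expectation ?M (\<lambda>om. favg n summand xstar + D * (q\<^sup>2 * (q\<^sup>2) ^ ?N om - q\<^sup>2 ^ m))"
    by (rule affine[OF finM, symmetric])
  also have "\<dots> \<le> pifo_expect m summand P gam x0 upd (favg n summand) t"
    unfolding pifo_expect_def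
  proof (intro integral_mono_AE int)
    show "AE om in ?M. favg n summand xstar + D * (q\<^sup>2 * (q\<^sup>2) ^ ?N om - q\<^sup>2 ^ m)
        \<le> favg n summand (pifo_iter m summand gam x0 upd om t)"
      unfolding AE_measure_pmf_iff using pt by blast
  qed
  finally show ?thesis by (simp add: D_def)
qed

end

section \<open>Choice of the parameters\<close>

text \<open>The root of the quadratic is \<open>(s - 1) / (s + 1)\<close> with
  \<open>s = sqrt (1 + 4 * \<nu> / 5)\<close>. The lower bound on \<open>- ln q\<close> will fix the
  dimension, the upper bound the number of queries.\<close>

lemma contraction_rate_exists:
  fixes \<nu> :: real
  assumes nu: "\<nu> \<ge> 0.85"
  shows "\<exists>q. 1 / 8 \<le> q \<and> q < 1 \<and> \<nu> / 5 * (1 - q)\<^sup>2 = q \<and>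
    1 / (2 * sqrt \<nu>) \<le> - ln q \<and> (1 + sqrt \<nu>) * (- ln q) \<le> 30"
proof -
  define r where "r = sqrt \<nu>"
  have r2: "r\<^sup>2 = \<nu>" using nu by (simp add: r_def)
  have r: "r \<ge> 9 / 10" unfolding r_def using nu by (intro real_le_rsqrt) (simp add: power2_eq_square)
  define s where "s = sqrt (1 + 4 * \<nu> / 5)"
  have s2: "s\<^sup>2 = 1 + 4 * \<nu> / 5" using nu by (simp add: s_def)
  \<comment> \<open>At \<open>s = 9 / 7\<close> the quotient \<open>(s - 1) / (s + 1)\<close> equals
    1/8.\<close>
  have s_lower: "s \<ge> 9 / 7"
    unfolding s_def using nu by (intro real_le_rsqrt) (simp add: power2_eq_square)
  have s_upper: "s \<le> 1 + r"
    unfolding s_def using nu r r2 by (intro real_le_lsqrt) (auto simp: power2_sum)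
  define q where "q = (s - 1) / (s + 1)"
  have q1: "1 - q = 2 / (s + 1)" using s_lower by (simp add: q_def field_simps)
  have q_lower: "1 / 8 \<le> q" using s_lower by (simp add: q_def field_simps)
  have q_upper: "q < 1" using s_lower by (simp add: q_def field_simps)
  have nu_s: "4 * \<nu> / 5 = (s - 1) * (s + 1)" using s2 by (simp add: power2_eq_square algebra_simps)
  have "\<nu> / 5 * (1 - q)\<^sup>2 = (4 * \<nu> / 5) / (s + 1)\<^sup>2" unfolding q1 by (simp add: power_divide)
  also have "\<dots> = q" unfolding nu_s q_def using s_lower by (simp add: power2_eq_square)
  finally have fp: "\<nu> / 5 * (1 - q)\<^sup>2 = q" .
  have "1 / (2 * r) \<le> 2 / (s + 1)" using s_upper s_lower r by (simp add: field_simps)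
  also have "\<dots> \<le> - ln q" using ln_le_minus_one[of q] q_lower q1 by simp
  finally have low: "1 / (2 * r) \<le> - ln q" .
  have "- ln q = ln (1 / q)" using q_lower by (simp add: ln_div)
  also have "\<dots> \<le> 1 / q - 1" using q_lower by (intro ln_le_minus_one) auto
  also have "\<dots> = 2 / (s - 1)" using s_lower by (simp add: q_def field_simps)
  also have "\<dots> = 2 * (s + 1) / ((s - 1) * (s + 1))"
    using s_lower by (intro nonzero_mult_divide_mult_cancel_right[symmetric]) auto
  also have "\<dots> = 5 * (s + 1) / (2 * r\<^sup>2)" unfolding nu_s[symmetric] r2 using nu by (simp add: field_simps)
  also have "\<dots> \<le> 5 * (4 * r) / (2 * r\<^sup>2)"
    using s_upper r by (intro divide_right_mono mult_left_mono) auto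
  also have "\<dots> = 10 / r" using r by (simp add: power2_eq_square)
  finally have "(1 + r) * (- ln q) \<le> (1 + r) * (10 / r)" using r by (intro mult_left_mono) auto
  also have "\<dots> \<le> 30" using r by (simp add: field_simps)
  finally have up: "(1 + r) * (- ln q) \<le> 30" .
  show ?thesis using q_lower q_upper fp low up unfolding r_def by blast
qed

text \<open>The second bound is the smoothness condition divided by \<open>\<mu>\<^sup>2\<close>,
  for the coupling \<open>c = \<mu> * \<kappa> / (5 * sqrt n)\<close>.\<close>

lemma kappa_bounds:
  fixes \<kappa> :: real
  assumes n: "n \<ge> (2::nat)" and k: "\<kappa> \<ge> sqrt (3 / real n) * (real n / 2 + 1)"
  shows "\<kappa> / sqrt (real n) \<ge> 0.85"
    and "1 + 8 * (\<kappa> / (5 * sqrt (real n))) + 8 * real n * (\<kappa> / (5 * sqrt (real n)))\<^sup>2 \<le> \<kappa>\<^sup>2"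
proof -
  have n0: "real n \<ge> 2" using n by simp
  have k_pos: "\<kappa> > 0" by (rule less_le_trans[OF _ k]) (use n0 in simp)
  have "sqrt (real n) * 0.85 \<le> sqrt (3 / real n) * (real n / 2 + 1)"
  proof (rule power2_le_imp_le)
    have "(sqrt (real n) * 0.85)\<^sup>2 = 0.7225 * real n"
      using n0 by (simp add: power_mult_distrib power2_eq_square)
    also have "\<dots> \<le> 3 * real n / 4 + 3" using n0 by simp
    also have "\<dots> \<le> 3 * real n / 4 + 3 + 3 / real n" by simp
    also have "\<dots> = (sqrt (3 / real n) * (real n / 2 + 1))\<^sup>2"
      using n0 by (simp add: power_mult_distrib) (simp add: field_simps power2_eq_square)
    finally show "(sqrt (real n) * 0.85)\<^sup>2 \<le> (sqrt (3 / real n) * (real n / 2 + 1))\<^sup>2" .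
  qed (use n0 in simp)
  then have "sqrt (real n) * 0.85 \<le> \<kappa>" using k by linarith
  then show "\<kappa> / sqrt (real n) \<ge> 0.85" using n0 by (simp add: field_simps)
  \<comment> \<open>The squared threshold is smallest at \<open>n = 2\<close>, with value 6; hence
    the square of \<open>n / 2 - 1\<close> in the difference.\<close>
  have "6 \<le> (sqrt (3 / real n) * (real n / 2 + 1))\<^sup>2"
  proof -
    have "(sqrt (3 / real n) * (real n / 2 + 1))\<^sup>2 - 6 = 3 * (real n / 2 - 1)\<^sup>2 / real n"
      using n0 by (simp add: power_mult_distrib) (simp add: field_simps power2_eq_square)
    moreover have "\<dots> \<ge> 0" by simp
    ultimately show ?thesis by linarith
  qed
  also have "\<dots> \<le> \<kappa>\<^sup>2" using k n0 by (intro power_mono) auto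
  finally have k6: "6 \<le> \<kappa>\<^sup>2" .
  have k24: "\<kappa> \<ge> 12 / 5"
    using k6 k_pos by (intro power2_le_imp_le[of "12 / 5" \<kappa>]) (auto simp: power2_eq_square)
  have sn: "sqrt (real n) \<ge> 7 / 5"
    using n0 by (intro real_le_rsqrt) (simp add: power2_eq_square)
  have "\<kappa> / (5 * sqrt (real n)) \<le> \<kappa> / (5 * (7 / 5))"
    using sn k_pos n0 by (intro divide_left_mono mult_left_mono) auto
  then have 1: "8 * (\<kappa> / (5 * sqrt (real n))) \<le> 8 / 7 * \<kappa>" by simp
  have "8 / 7 * \<kappa> * (12 / 5) \<le> 8 / 7 * \<kappa> * \<kappa>" using k24 k_pos by (intro mult_left_mono) auto
  then have 2: "8 / 7 * \<kappa> \<le> 10 / 21 * \<kappa>\<^sup>2" by (simp add: power2_eq_square)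
  have 3: "8 * real n * (\<kappa> / (5 * sqrt (real n)))\<^sup>2 = 8 / 25 * \<kappa>\<^sup>2"
    using n0 by (simp add: power_divide power_mult_distrib)
  show "1 + 8 * (\<kappa> / (5 * sqrt (real n))) + 8 * real n * (\<kappa> / (5 * sqrt (real n)))\<^sup>2 \<le> \<kappa>\<^sup>2"
    \<comment> \<open>The three terms are at most 1/6, 10/21 and 8/25 of
      \<open>\<kappa>\<^sup>2\<close>, and these fractions sum to less than 1.\<close>
    unfolding 3 using 1 2 k6 by linarith
qed

text \<open>Here \<open>q\<^sup>2\<close> is the price of the coordinate spent on the direction of the initial point;
  it is affordable because \<open>q\<^sup>2 \<ge> 1 / 64\<close>, whereas \<open>\<delta>\<close> is below \<open>1 / 305\<close>.\<close>

lemma final_accuracy: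
  fixes \<delta> q x :: real
  assumes d: "0 < \<delta>" "\<delta> \<le> 0.00327" and q: "1 / 8 \<le> q" "q < 1"
    and x: "x \<ge> - ln (1 / \<delta>) / 10" and m: "2 * real m * (- ln q) \<ge> ln (1 / \<delta>) + ln 2"
  shows "(q\<^sup>2 * exp x - q\<^sup>2 ^ m) / (1 + q) \<ge> \<delta>"
proof -
  define e where "e = exp (- ln (1 / \<delta>) / 10)"
  have e0: "e > 0" by (simp add: e_def)
  have e10: "e ^ 10 = \<delta>"
    using d by (simp add: e_def exp_of_nat_mult[symmetric] ln_div)
  \<comment> \<open>This says that \<open>\<delta>\<close> to the power 9/10 is at most 1/160; the
    tenth power reduces it to arithmetic at 0.00327.\<close>
  have e9: "160 * e ^ 9 \<le> 1"
  proof (rule ccontr)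
    assume "\<not> ?thesis"
    then have "1 < (160 * e ^ 9) ^ 10" by (intro one_less_power) auto
    also have "\<dots> = 160 ^ 10 * (e ^ 10) ^ 9" by (simp add: power_mult_distrib power_mult[symmetric])
    also have "\<dots> \<le> 160 ^ 10 * 0.00327 ^ 9"
      unfolding e10 using d by (intro mult_left_mono power_mono) auto
    also have "\<dots> \<le> (1::real)" by (simp add: field_simps)
    finally show False by simp
  qed
  have "160 * \<delta> = (160 * e ^ 9) * e" unfolding e10[symmetric] by (simp add: eval_nat_numeral)
  also have "\<dots> \<le> 1 * e" using e9 e0 by (intro mult_right_mono) auto
  also have "\<dots> \<le> exp x" unfolding e_def using x by simp
  finally have ex: "160 * \<delta> \<le> exp x" .
  have "(1 / 8)\<^sup>2 \<le> q\<^sup>2" using q by (intro power_mono) auto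
  then have "(1 / 64) * (160 * \<delta>) \<le> q\<^sup>2 * exp x"
    using ex d by (intro mult_mono) (auto simp: power2_eq_square)
  moreover have "q\<^sup>2 ^ m \<le> \<delta> / 2"
  proof -
    have "q\<^sup>2 ^ m = exp (real m * ln (q\<^sup>2))" using q by (simp add: exp_of_nat_mult)
    also have "\<dots> = exp (2 * real m * ln q)" using q by (simp add: ln_realpow)
    also have "\<dots> \<le> exp (ln (\<delta> / 2))" using m d by (simp add: ln_div)
    finally show ?thesis using d by simp
  qed
  \<comment> \<open>The first term is at least \<open>160 / 64 = 5 / 2\<close> times
    \<open>\<delta>\<close>, the second at most half of \<open>\<delta>\<close>. The factor 2 left
    over pays for \<open>1 + q < 2\<close>.\<close>
  ultimately have "2 * \<delta> \<le> q\<^sup>2 * exp x - q\<^sup>2 ^ m" by linarith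
  moreover have "\<delta> * (1 + q) \<le> \<delta> * 2" using q d by (intro mult_left_mono) auto
  ultimately have "\<delta> * (1 + q) \<le> q\<^sup>2 * exp x - q\<^sup>2 ^ m" by linarith
  then show ?thesis using q by (simp add: pos_le_divide_eq)
qed

lemma powr_kappa:
  fixes \<kappa> :: real
  assumes "n > (0::nat)" "\<kappa> > 0"
  shows "real n powr (-1/4) * sqrt \<kappa> = sqrt (\<kappa> / sqrt (real n))"
    and "real n powr (3/4) * sqrt \<kappa> = real n * sqrt (\<kappa> / sqrt (real n))"
proof -
  have "sqrt (sqrt (real n)) = real n powr (1/4)"
    using assms by (simp add: powr_half_sqrt[symmetric] powr_powr)
  then have 1: "sqrt (\<kappa> / sqrt (real n)) = sqrt \<kappa> * real n powr (-1/4)"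
    by (simp add: real_sqrt_divide powr_minus_divide)
  then show "real n powr (-1/4) * sqrt \<kappa> = sqrt (\<kappa> / sqrt (real n))" by simp
  have "real n powr (3/4) = real n powr (1 + -1/4)" by simp
  also have "\<dots> = real n * real n powr (-1/4)" using assms unfolding powr_add by simp
  finally show "real n powr (3/4) * sqrt \<kappa> = real n * sqrt (\<kappa> / sqrt (real n))"
    unfolding 1 by simp
qed

theorem theorem3p3:
  shows "\<exists>c::real>0. \<exists>C::real>0. \<forall>(n::nat) (L::real) (\<mu>::real) (\<Delta>::real) (\<epsilon>::real).
    n \<ge> 2 \<and> L > 0 \<and> \<mu> > 0 \<and> \<Delta> > 0 \<and> \<epsilon> > 0 \<and>
    L / \<mu> \<ge> sqrt (3 / real n) * (real n / 2 + 1) \<and> \<epsilon> / \<Delta> \<le> 0.00327 \<longrightarrow>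
    (\<forall>(P :: nat \<Rightarrow> nat pmf) (gam :: nat \<Rightarrow> nat \<Rightarrow> real) (x0 :: nat \<Rightarrow> vec)
        (upd :: nat \<Rightarrow> nat \<Rightarrow> obs list \<Rightarrow> vec).
       (\<forall>d. pifo_alg n d (P d) (gam d) (x0 d) (upd d)) \<longrightarrow>
       (\<exists>(d::nat) (f :: nat \<Rightarrow> vec \<Rightarrow> real).
          real d \<le> C * real n powr (-1/4) * sqrt (L / \<mu>) * ln (\<Delta> / \<epsilon>) \<and>
          avg_smooth d n L f \<and>
          strongly_convex_Rd d \<mu> (favg n f) \<and>
          (\<exists>xstar\<in>Rd d. (\<forall>y\<in>Rd d. favg n f xstar \<le> favg n f y) \<and>
             favg n f (x0 d) - favg n f xstar = \<Delta> \<and>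
             (\<forall>t::nat. real t \<le> c * (real n + real n powr (3/4) * sqrt (L / \<mu>)) * ln (\<Delta> / \<epsilon>)
                \<longrightarrow> pifo_expect d f (P d) (gam d) (x0 d) (upd d) (favg n f) t - favg n f xstar \<ge> \<epsilon>))))"
proof (rule exI[of _ "1 / 1800"], rule conjI, simp, rule exI[of _ 4], rule conjI, simp,
    intro allI impI, elim conjE)
  fix n :: nat and L \<mu> \<Delta> \<epsilon> :: real
    and P :: "nat \<Rightarrow> nat pmf" and gam :: "nat \<Rightarrow> nat \<Rightarrow> real" and x0 :: "nat \<Rightarrow> vec"
    and upd :: "nat \<Rightarrow> nat \<Rightarrow> obs list \<Rightarrow> vec"
  assume n: "n \<ge> 2" and pos: "L > 0" "\<mu> > 0" "\<Delta> > 0" "\<epsilon> > 0"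
    and kap: "sqrt (3 / real n) * (real n / 2 + 1) \<le> L / \<mu>" and del: "\<epsilon> / \<Delta> \<le> 0.00327"
    and alg: "\<forall>d. pifo_alg n d (P d) (gam d) (x0 d) (upd d)"
  define \<kappa> where "\<kappa> = L / \<mu>"
  define \<nu> where "\<nu> = \<kappa> / sqrt (real n)"
  define \<Lambda> where "\<Lambda> = ln (\<Delta> / \<epsilon>)"
  \<comment> \<open>Equals \<open>L / (5 * sqrt n)\<close>, the order of coupling that average
    smoothness permits.\<close>
  define c where "c = \<mu> * (\<nu> / 5)"
  have n0: "real n > 0" using n by simp
  have kpos: "\<kappa> > 0" using pos by (simp add: \<kappa>_def)
  have nu: "\<nu> \<ge> 0.85" unfolding \<nu>_def using kappa_bounds(1)[OF n kap] by (simp add: \<kappa>_def)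
  have pw: "real n powr (-1/4) * sqrt \<kappa> = sqrt \<nu>" "real n powr (3/4) * sqrt \<kappa> = real n * sqrt \<nu>"
    unfolding \<nu>_def using powr_kappa n kpos by simp_all
  obtain q where q: "1 / 8 \<le> q" "q < 1" "\<nu> / 5 * (1 - q)\<^sup>2 = q"
    "1 / (2 * sqrt \<nu>) \<le> - ln q" "(1 + sqrt \<nu>) * (- ln q) \<le> 30"
    using contraction_rate_exists[OF nu] by blast
  have Lam: "\<Lambda> \<ge> 1"
  proof -
    have "exp 1 \<le> (3::real)" by (rule exp_le)
    also have "\<dots> \<le> \<Delta> / \<epsilon>" using del pos by (simp add: field_simps)
    finally show ?thesis unfolding \<Lambda>_def using pos by (subst ln_ge_iff) auto
  qed
  have snu: "sqrt \<nu> \<ge> 1 / 2" using nu by (intro real_le_rsqrt) (simp add: power2_eq_square)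
  \<comment> \<open>Enough coordinates to bring \<open>q\<^sup>2 ^ m\<close> below half of
    \<open>\<epsilon> / \<Delta>\<close>. As \<open>2 * sqrt \<nu> * \<Lambda> \<ge> 1\<close>,
    rounding up at most doubles the value, whence the constant 4.\<close>
  define m where "m = nat \<lceil>2 * sqrt \<nu> * \<Lambda>\<rceil>"
  have "1 \<le> 2 * sqrt \<nu> * \<Lambda>" using mult_mono[of "1/2" "sqrt \<nu>" 1 \<Lambda>] snu Lam nu by simp
  then have m_low: "real m \<ge> 2 * sqrt \<nu> * \<Lambda>" and m_up: "real m \<le> 4 * sqrt \<nu> * \<Lambda>" and m1: "m \<ge> 1"
    unfolding m_def by linarith+
  \<comment> \<open>The value of \<open>B\<^sup>2\<close> for which the initial gap is
    \<open>\<Delta>\<close>.\<close>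
  define D where "D = 2 * \<Delta> / (\<mu> * (1 - q))"
  define B where "B = sqrt D"
  have "D > 0" using pos q by (simp add: D_def)
  then have B2: "B\<^sup>2 = D" by (simp add: B_def)
  have \<Delta>_eq: "\<mu> / 2 * B\<^sup>2 * (1 - q) = \<Delta>" unfolding B2 D_def using pos q by simp
  \<comment> \<open>The algorithm may differ between dimensions, so \<open>m\<close> is fixed first;
    rotation and rare pair are then chosen for \<open>x0 m\<close> and \<open>P m\<close>.\<close>
  have x0R: "x0 m \<in> Rd m" using alg by (simp add: pifo_alg_def)
  obtain H where H: "linear_isometry_Rd m H" "H (x0 m) \<in> Rd 1"
    using householder_exists[OF m1 x0R] by blast
  obtain a b where ab: "a < n" "b < n" "a \<noteq> b" "measure_pmf.prob (P m) {a, b} \<le> 3 / real n"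
    using exists_rare_pair[OF n] by blast
  interpret hi: hard_instance m H "H (x0 m)" n a b \<mu> B c q
  proof (intro hard_instance.intro hard_instance_axioms.intro H m1 ab pos)
    show "c > 0" using pos nu by (simp add: c_def)
    show "0 < q" "q < 1" using q by auto
    show "c * (1 - q)\<^sup>2 = \<mu> * q" unfolding c_def mult.assoc q(3) ..
  qed
  have smooth: "avg_smooth m n L hi.summand"
  proof (rule hi.summand_avg_smooth)
    have k5: "\<nu> / 5 = \<kappa> / (5 * sqrt (real n))" by (simp add: \<nu>_def)
    have "\<mu>\<^sup>2 + 8 * \<mu> * c + 8 * real n * c\<^sup>2 = \<mu>\<^sup>2 * (1 + 8 * (\<nu> / 5) + 8 * real n * (\<nu> / 5)\<^sup>2)"
      by (simp add: c_def power2_eq_square algebra_simps)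
    also have "\<dots> \<le> \<mu>\<^sup>2 * \<kappa>\<^sup>2"
      unfolding k5 using kappa_bounds(2)[OF n kap] by (intro mult_left_mono) (auto simp: \<kappa>_def)
    also have "\<dots> = L\<^sup>2" using pos by (simp add: \<kappa>_def power_divide)
    finally show "\<mu>\<^sup>2 + 8 * \<mu> * c + 8 * real n * c\<^sup>2 \<le> L\<^sup>2" .
  qed
  have gap: "pifo_expect m hi.summand (P m) (gam m) (x0 m) (upd m) (favg n hi.summand) t
      - favg n hi.summand hi.xstar \<ge> \<epsilon>"
    if t: "real t \<le> 1 / 1800 * (real n + real n powr (3/4) * sqrt (L / \<mu>)) * ln (\<Delta> / \<epsilon>)" for t
  proof -
    have lnq: "- ln q \<ge> 0" using q by simp
    have "real t \<le> real n * ((1 + sqrt \<nu>) * \<Lambda> / 1800)"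
      using t unfolding \<kappa>_def[symmetric] pw \<Lambda>_def[symmetric] by (simp add: algebra_simps)
    then have tn: "real t / real n \<le> (1 + sqrt \<nu>) * \<Lambda> / 1800" using n0 by (simp add: field_simps)
    \<comment> \<open>The two factors 2 and 3 in the exponent give 6, and
      \<open>6 * 30 / 1800 = 1 / 10\<close> is the exponent that \<open>final_accuracy\<close>
      tolerates; this fixes the constant 1/1800.\<close>
    have "6 * (real t / real n) * (- ln q) \<le> 6 * ((1 + sqrt \<nu>) * \<Lambda> / 1800) * (- ln q)"
      using tn lnq by (intro mult_right_mono mult_left_mono) auto
    also have "\<dots> = \<Lambda> / 300 * ((1 + sqrt \<nu>) * (- ln q))" by simp
    also have "\<dots> \<le> \<Lambda> / 300 * 30" using q(5) Lam by (intro mult_left_mono) auto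
    finally have x: "2 * (3 / real n) * real t * ln q \<ge> - \<Lambda> / 10" by simp
    have "\<Lambda> + ln 2 \<le> 2 * \<Lambda>" using Lam ln2_le_25_over_36 by linarith
    also have "\<dots> = 2 * (2 * sqrt \<nu> * \<Lambda>) * (1 / (2 * sqrt \<nu>))" using nu by simp
    also have "\<dots> \<le> 2 * real m * (- ln q)"
      using m_low q(4) nu Lam by (intro mult_mono) auto
    finally have mm: "2 * real m * (- ln q) \<ge> \<Lambda> + ln 2" .
    have "\<epsilon> / \<Delta> \<le> (q\<^sup>2 * exp (2 * (3 / real n) * real t * ln q) - q\<^sup>2 ^ m) / (1 + q)"
      using x mm pos by (intro final_accuracy del q) (auto simp: \<Lambda>_def)
    then have "\<epsilon> \<le> \<Delta> * ((q\<^sup>2 * exp (2 * (3 / real n) * real t * ln q) - q\<^sup>2 ^ m) / (1 + q))"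
      using pos by (simp add: pos_divide_le_eq mult.commute)
    also have "\<dots> \<le> pifo_expect m hi.summand (P m) (gam m) (x0 m) (upd m) (favg n hi.summand) t
      - favg n hi.summand hi.xstar"
      using hi.pifo_expect_lower_bound[OF alg[rule_format] refl ab(4), of t] unfolding \<Delta>_eq .
    finally show ?thesis .
  qed
  have "real m \<le> 4 * real n powr (-1/4) * sqrt (L / \<mu>) * ln (\<Delta> / \<epsilon>)"
    using m_up unfolding \<kappa>_def[symmetric] \<Lambda>_def[symmetric] pw(1)[symmetric] by (simp only: mult.assoc)
  then show "\<exists>(d::nat) (f :: nat \<Rightarrow> vec \<Rightarrow> real).
          real d \<le> 4 * real n powr (-1/4) * sqrt (L / \<mu>) * ln (\<Delta> / \<epsilon>) \<and>
          avg_smooth d n L f \<and>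
          strongly_convex_Rd d \<mu> (favg n f) \<and>
          (\<exists>xstar\<in>Rd d. (\<forall>y\<in>Rd d. favg n f xstar \<le> favg n f y) \<and>
             favg n f (x0 d) - favg n f xstar = \<Delta> \<and>
             (\<forall>t::nat. real t \<le> 1 / 1800 * (real n + real n powr (3/4) * sqrt (L / \<mu>)) * ln (\<Delta> / \<epsilon>)
                \<longrightarrow> pifo_expect d f (P d) (gam d) (x0 d) (upd d) (favg n f) t - favg n f xstar \<ge> \<epsilon>))"
    using smooth hi.favg_strongly_convex hi.xstar_Rd hi.xstar_minimal
      hi.favg_initial_gap[OF refl, unfolded \<Delta>_eq] gap
    by (intro exI[of _ m] exI[of _ hi.summand] conjI bexI[of _ hi.xstar]) auto
qed

end
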